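(* Let $d\ge 1$ be an integer and $q\in\{2,4\}$. Consider the following variational problem over functions $G:[0,\infty)\to\mathbb{R}$: minimize $B_{d,q}(G)^{2(d+2)}\cdot V_{d,1}(G)^{2q}$ subject to (i) $B_{d,0}(G)=b_d^{-1}$, $B_{d,i}(G)=0$ for all $i\in\{2,4,\ldots,q-2\}$, and $B_{d,q}(G)\neq 0$; (ii) $G$ is differentiable and $G^{(1)}$ is integrable; (iii) $G$ changes its sign exactly $(\tfrac{q}{2}-1)$ times on $[0,\infty)$; (iv) $V_{d,1}(G)<\infty$; (v) $x^{d+q}G(x)\to 0$ as $x\to\infty$. Then a solution (minimizer) of this problem is the function $$G^B_{d,q}(x)=\Big(\sum_{i\in\{0,2,4,\ldots,q+2\}} c^B_{d,q,i}\,x^i\Big)\mathbbm{1}_{x\le 1},\qquad c^B_{d,q,i}=\frac{(-1)^{i/2}\,\Gamma(\frac{d+q+4}{2})\,\Gamma(\frac{d+q+i}{2})}{\pi^{d/2}\,\Gamma(\frac q2)\,\Gamma(\frac{2+i}{2})\,\Gamma(\frac{d+2+i}{2})\,\Gamma(\frac{q+4-i}{2})}.$$ Moreover, $G^B_{d,q}$ can also be written as $$G^B_{d,q}(x)=\frac{\Gamma(\frac{d+q}{2})}{\pi^{d/2}\Gamma(\frac q2)}P^{(\frac d2,-2)}_{\frac q2+1}(1-2x^2)\mathbbm{1}_{x\le1}=(-1)^{\frac q2+1}\frac{\Gamma(\frac{d+q}{2}+2)}{\pi^{d/2}\Gamma(\frac q2+2)}(1-x^2)^2P^{(2,\frac d2)}_{\frac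 q2-1}(2x^2-1)\mathbbm{1}_{x\le 1}.$$
   Context: For a function $G:[0,\infty)\to\mathbb{R}$, integers $d\ge1$, $i\ge0$, $l\ge 0$: $B_{d,i}(G)=\int_0^\infty x^{d-1+i}G(x)\,dx$ and $V_{d,l}(G)=\int_0^\infty x^{d-1}\{G^{(l)}(x)\}^2\,dx$, where $G^{(l)}$ is the $l$-th derivative. $b_d=2\pi^{d/2}/\Gamma(d/2)$. $P^{(\alpha,\beta)}_n$ is the Jacobi polynomial $P_n^{(\alpha,\beta)}(x)=\frac{(-1)^n}{2^nn!}(1-x)^{-\alpha}(1+x)^{-\beta}\frac{d^n}{dx^n}[(1-x)^{n+\alpha}(1+x)^{n+\beta}]$. A function $g$ on an interval $[a,b]$ is said to change its sign $k$ times on $[a,b]$ if there are $a=x_0<x_1<\cdots<x_{k+1}=b$ such that, with $S_j=[x_{j-1},x_j]$, (i) for each $j$, either $g\le0$ on $S_j$ and $g<0$ somewhere in $S_j$, or $g\ge0$ on $S_j$ and $g>0$ somewhere in $S_j$; (ii) if $k\ge1$, $g(x)g(y)\le0$ for all $x\in S_j$, $y\in S_{j+1}$, $j=1,\ldots,k$. A "solution" means a function satisfying all constraints and attaining the minimum of the objective among all such functions. (Here $G$ is the radial profile of a radial kernel $K(\mathbf{x})=G(\|\mathbf{x}\|)$ on $\mathbb{R}^d$.) *)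

theory Defs
  imports "HOL-Analysis.Analysis" "HOL-Computational_Algebra.Polynomial"
begin

definition Bmom :: "nat \<Rightarrow> nat \<Rightarrow> (real \<Rightarrow> real) \<Rightarrow> real" where
  "Bmom d i G = (LINT x:{0..}|lborel. x ^ (d - 1 + i) * G x)"

definition Bmom_exists :: "nat \<Rightarrow> nat \<Rightarrow> (real \<Rightarrow> real) \<Rightarrow> bool" where
  "Bmom_exists d i G \<longleftrightarrow> set_integrable lborel {0..} (\<lambda>x. x ^ (d - 1 + i) * G x)"

text \<open>V_{d,l}(G) as an extended nonnegative real, applied to the l-th derivative Gl of G.\<close>
definition Vfun_ennreal :: "nat \<Rightarrow> (real \<Rightarrow> real) \<Rightarrow> ennreal" where
  "Vfun_ennreal d Gl = (\<integral>\<^sup>+ x\<in>{0..}. ennreal (x ^ (d - 1) * (Gl x)\<^sup>2) \<partial>lborel)"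

definition Vfun :: "nat \<Rightarrow> (real \<Rightarrow> real) \<Rightarrow> real" where
  "Vfun d Gl = enn2real (Vfun_ennreal d Gl)"

definition b_const :: "nat \<Rightarrow> real" where
  "b_const d = 2 * pi powr (real d / 2) / Gamma (real d / 2)"

definition seg :: "(nat \<Rightarrow> real) \<Rightarrow> nat \<Rightarrow> nat \<Rightarrow> real set" where
  "seg xs k j = (if j \<le> k then {xs (j - 1) .. xs j} else {xs k ..})"

definition changes_sign :: "(real \<Rightarrow> real) \<Rightarrow> nat \<Rightarrow> bool" where
  "changes_sign g k \<longleftrightarrow>
     (\<exists>xs :: nat \<Rightarrow> real. xs 0 = 0 \<and> (\<forall>j<k. xs j < xs (Suc j)) \<and>
        (\<forall>j\<in>{1..k+1}.
           ((\<forall>x\<in>seg xs k j. g x \<le> 0) \<and> (\<exists>x\<in>seg xs k j. g x < 0)) \<or>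
           ((\<forall>x\<in>seg xs k j. g x \<ge> 0) \<and> (\<exists>x\<in>seg xs k j. g x > 0))) \<and>
        (k \<ge> 1 \<longrightarrow> (\<forall>j\<in>{1..k}. \<forall>x\<in>seg xs k j. \<forall>y\<in>seg xs k (j + 1). g x * g y \<le> 0)))"

definition feasible :: "nat \<Rightarrow> nat \<Rightarrow> (real \<Rightarrow> real) \<Rightarrow> (real \<Rightarrow> real) \<Rightarrow> bool" where
  "feasible d q G G' \<longleftrightarrow>
     Bmom_exists d 0 G \<and> Bmom d 0 G = 1 / b_const d \<and>
     (\<forall>i\<in>{2..q-2}. even i \<longrightarrow> Bmom_exists d i G \<and> Bmom d i G = 0) \<and>
     Bmom_exists d q G \<and> Bmom d q G \<noteq> 0 \<and>
     (\<forall>x\<ge>0. (G has_real_derivative G' x) (at x within {0..})) \<and>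
     set_integrable lborel {0..} G' \<and>
     changes_sign G (q div 2 - 1) \<and>
     Vfun_ennreal d G' < \<infinity> \<and>
     ((\<lambda>x. x ^ (d + q) * G x) \<longlongrightarrow> 0) at_top"

definition objective :: "nat \<Rightarrow> nat \<Rightarrow> (real \<Rightarrow> real) \<Rightarrow> (real \<Rightarrow> real) \<Rightarrow> real" where
  "objective d q G G' = Bmom d q G ^ (2 * (d + 2)) * Vfun d G' ^ (2 * q)"

text \<open>Jacobi polynomials via the Rodrigues formula; the formula is evaluated on (-1,1)
  and the Jacobi polynomial is the (unique) polynomial agreeing with it there.\<close>
definition jacobi_rodrigues :: "nat \<Rightarrow> real \<Rightarrow> real \<Rightarrow> real \<Rightarrow> real" where
  "jacobi_rodrigues n a b x =
     (-1) ^ n / (2 ^ n * fact n) * (1 - x) powr (- a) * (1 + x) powr (- b) *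
     (deriv ^^ n) (\<lambda>y. (1 - y) powr (real n + a) * (1 + y) powr (real n + b)) x"

definition jacobiP :: "nat \<Rightarrow> real \<Rightarrow> real \<Rightarrow> real \<Rightarrow> real" where
  "jacobiP n a b x =
     poly (THE p :: real poly. \<forall>y\<in>{-1<..<1}. poly p y = jacobi_rodrigues n a b y) x"

definition cB :: "nat \<Rightarrow> nat \<Rightarrow> nat \<Rightarrow> real" where
  "cB d q i = (-1) ^ (i div 2) * Gamma ((real d + real q + 4) / 2) * Gamma ((real d + real q + real i) / 2) /
     (pi powr (real d / 2) * Gamma (real q / 2) * Gamma ((2 + real i) / 2) *
      Gamma ((real d + 2 + real i) / 2) * Gamma ((real q + 4 - real i) / 2))"

definition GB :: "nat \<Rightarrow> nat \<Rightarrow> real \<Rightarrow> real" where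
  "GB d q x = (\<Sum>i\<in>{i\<in>{0..q+2}. even i}. cB d q i * x ^ i) * (if x \<le> 1 then 1 else 0)"

end

theory Submission
  imports Defs
begin

text \<open>
  Put \<open>t = x\<^sup>2\<close>.  On \<open>[0,1]\<close> the kernel is \<open>g = C (1 - t)\<^sup>2 (A - B t)\<close>, and \<open>-(x\<^bsup>d-1\<^esup> g')' = x\<^bsup>d-1\<^esup> P(t)\<close> for a
  polynomial \<open>P\<close> of degree \<open>q/2\<close> in \<open>t\<close>.  By scale invariance of the objective a competitor \<open>G\<close> may be
  rescaled so that \<open>B\<^bsub>d,q\<^esub>(G) = B\<^bsub>d,q\<^esub>(g)\<close>.  Since \<open>x\<^bsup>d-1\<^esup> g'\<close> vanishes at 0 and at 1, integration by parts
  turns \<open>\<integral> x\<^bsup>d-1\<^esup> g' G'\<close> into \<open>\<integral>\<^sub>0\<^sup>1 x\<^bsup>d-1\<^esup> P G\<close>.  The sign condition on \<open>G\<close> bounds this below by the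
  integral of \<open>x\<^bsup>d-1\<^esup> P G\<close> over the half line, which depends only on the prescribed moments and equals
  \<open>V\<^bsub>d,1\<^esub>(g)\<close>; expanding \<open>(G' - g')\<^sup>2 \<ge> 0\<close> concludes.  For \<open>q = 4\<close> the sign change of \<open>G\<close> may lie outside
  \<open>[0,1]\<close>; then \<open>P\<close> is replaced by \<open>P - \<kappa> t\<close>, which has the same integral against \<open>G\<close> because the second
  moment of \<open>G\<close> is zero.
\<close>

section \<open>Integrals on the half line\<close>

lemma continuous_mult_set_integrable:
  fixes k H :: "real \<Rightarrow> real"
  assumes "continuous_on {a..b} k" and "set_integrable lborel {a..b} H"
  shows "set_integrable lborel {a..b} (\<lambda>x. k x * H x)"
proof -
  obtain B where B: "\<And>x. x \<in> {a..b} \<Longrightarrow> norm (k x) \<le> B"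
    using compact_continuous_image[OF assms(1)] compact_imp_bounded bounded_iff
    by (metis compact_Icc imageI)
  have "(\<lambda>x. indicator {a..b} x *\<^sub>R k x) \<in> borel_measurable lborel"
    using borel_integrable_atLeastAtMost'[OF assms(1)]
    unfolding set_integrable_def by (rule borel_measurable_integrable)
  moreover have "(\<lambda>x. indicator {a..b} x *\<^sub>R H x) \<in> borel_measurable lborel"
    using assms(2) unfolding set_integrable_def by (rule borel_measurable_integrable)
  ultimately have "(\<lambda>x. (indicator {a..b} x *\<^sub>R k x) * (indicator {a..b} x *\<^sub>R H x))
      \<in> borel_measurable lborel"
    by (rule borel_measurable_times)
  also have "(\<lambda>x. (indicator {a..b} x *\<^sub>R k x) * (indicator {a..b} x *\<^sub>R H x)) =
      (\<lambda>x. indicator {a..b} x *\<^sub>R (k x * H x))"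
    by (auto simp: indicator_def)
  finally have "set_borel_measurable lborel {a..b} (\<lambda>x. k x * H x)"
    unfolding set_borel_measurable_def .
  moreover have "set_integrable lborel {a..b} (\<lambda>x. B * H x)"
    using assms(2) by simp
  moreover have "norm (k x * H x) \<le> norm (B * H x)" if "x \<in> {a..b}" for x
  proof -
    have "\<bar>k x\<bar> \<le> \<bar>B\<bar>" using B[OF that] by simp
    then show ?thesis
      unfolding real_norm_def abs_mult by (rule mult_right_mono) simp
  qed
  ultimately show ?thesis
    by - (rule set_integrable_bound[where f="\<lambda>x. B * H x"], auto)
qed

text \<open>\<open>H\<close> is merely integrable. The fundamental theorem for the gauge integral
  asks no regularity of the derivative, and its result passes to Lebesgue integrals because both
  summands of the product rule are integrable on the compact interval.\<close>

lemma integration_by_parts_vanishing_boundary: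
  fixes \<phi> \<phi>' G H :: "real \<Rightarrow> real"
  assumes ab: "a \<le> b"
    and \<phi>: "\<And>x. x \<in> {a..b} \<Longrightarrow> (\<phi> has_real_derivative \<phi>' x) (at x within {a..b})"
    and "continuous_on {a..b} \<phi>'" and "\<phi> a = 0" and "\<phi> b = 0"
    and G: "\<And>x. x \<in> {a..b} \<Longrightarrow> (G has_real_derivative H x) (at x within {a..b})"
    and H: "set_integrable lborel {a..b} H"
  shows "(LINT x:{a..b}|lborel. \<phi> x * H x) = - (LINT x:{a..b}|lborel. \<phi>' x * G x)"
proof -
  have cont: "continuous_on {a..b} \<phi>" "continuous_on {a..b} G"
    using \<phi> G by (meson DERIV_continuous continuous_on_eq_continuous_within)+
  have 1: "set_integrable lborel {a..b} (\<lambda>x. \<phi> x * H x)"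
    by (rule continuous_mult_set_integrable[OF cont(1) H])
  have 2: "set_integrable lborel {a..b} (\<lambda>x. \<phi>' x * G x)"
    by (intro borel_integrable_atLeastAtMost' continuous_intros assms cont)
  have "((\<lambda>x. \<phi> x * H x + \<phi>' x * G x) has_integral \<phi> b * G b - \<phi> a * G a) {a..b}"
    using ab \<phi> G
    by (intro fundamental_theorem_of_calculus)
       (auto intro!: derivative_eq_intros simp: has_real_derivative_iff_has_vector_derivative[symmetric])
  then have "integral {a..b} (\<lambda>x. \<phi> x * H x + \<phi>' x * G x) = 0"
    using assms by (simp add: integral_unique)
  then have "(LINT x:{a..b}|lborel. \<phi> x * H x + \<phi>' x * G x) = 0"
    using set_borel_integral_eq_integral(2)[OF set_integral_add(1)[OF 1 2]] by simp
  then show ?thesis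
    using set_integral_add(2)[OF 1 2] by simp
qed

lemma set_integral_atLeast_scale:
  fixes f :: "real \<Rightarrow> real"
  assumes "L > 0"
  shows "set_integrable lborel {0..} (\<lambda>x. f (L * x)) \<longleftrightarrow> set_integrable lborel {0..} f"
    and "(LINT x:{0..}|lborel. f (L * x)) = (LINT x:{0..}|lborel. f x) / L"
proof -
  have eq: "indicator {0..} (0 + L * x) *\<^sub>R f (0 + L * x) = indicator {0..} x *\<^sub>R f (L * x)" for x
    using assms by (auto simp: indicator_def zero_le_mult_iff)
  show "set_integrable lborel {0..} (\<lambda>x. f (L * x)) \<longleftrightarrow> set_integrable lborel {0..} f"
    using lborel_integrable_real_affine_iff[of L "\<lambda>x. indicator {0..} x *\<^sub>R f x" 0] assms
    unfolding set_integrable_def eq by simp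
  show "(LINT x:{0..}|lborel. f (L * x)) = (LINT x:{0..}|lborel. f x) / L"
    using lborel_integral_real_affine[of L "\<lambda>x. indicator {0..} x *\<^sub>R f x" 0] assms
    unfolding set_lebesgue_integral_def eq by simp
qed

lemma set_integral_atLeast_truncate:
  fixes f g :: "real \<Rightarrow> real"
  assumes "\<And>x. x \<ge> 0 \<Longrightarrow> f x = (if x \<le> 1 then g x else 0)"
  shows "set_integrable lborel {0..} f \<longleftrightarrow> set_integrable lborel {0..1} g"
    and "(LINT x:{0..}|lborel. f x) = (LINT x:{0..1}|lborel. g x)"
proof -
  have "(\<lambda>x. indicator {0..} x *\<^sub>R f x) = (\<lambda>x. indicator {0..1} x *\<^sub>R g x)"
    using assms by (auto simp: indicator_def)
  then show "set_integrable lborel {0..} f \<longleftrightarrow> set_integrable lborel {0..1} g"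
    and "(LINT x:{0..}|lborel. f x) = (LINT x:{0..1}|lborel. g x)"
    unfolding set_integrable_def set_lebesgue_integral_def by simp_all
qed

lemma set_integral_nonneg_real:
  fixes f :: "real \<Rightarrow> real"
  assumes "\<And>x. x \<in> A \<Longrightarrow> f x \<ge> 0"
  shows "(LINT x:A|lborel. f x) \<ge> 0"
  unfolding set_lebesgue_integral_def
  by (intro Bochner_Integration.integral_nonneg) (use assms in \<open>auto simp: indicator_def\<close>)

text \<open>The first equation also covers infinite energy: there \<open>enn2real\<close> and the
  Bochner integral of a nonintegrable function both default to 0.\<close>

lemma Vfun_eq_set_integral:
  assumes "set_borel_measurable lborel {0..} H"
  shows "Vfun d H = (LINT x:{0..}|lborel. x ^ (d - 1) * (H x)\<^sup>2)"
    and "Vfun_ennreal d H < \<infinity> \<longleftrightarrow> set_integrable lborel {0..} (\<lambda>x. x ^ (d - 1) * (H x)\<^sup>2)"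
proof -
  let ?f = "\<lambda>x. indicator {0..} x *\<^sub>R (x ^ (d - 1) * (H x)\<^sup>2)"
  have "(\<lambda>x. x ^ (d - 1) * (indicator {0..} x *\<^sub>R H x)\<^sup>2) \<in> borel_measurable lborel"
    using assms unfolding set_borel_measurable_def by simp
  also have "(\<lambda>x. x ^ (d - 1) * (indicator {0..} x *\<^sub>R H x)\<^sup>2) = ?f"
    by (auto simp: indicator_def)
  finally have f: "?f \<in> borel_measurable lborel" .
  have nonneg: "?f x \<ge> 0" for x
    by (auto simp: indicator_def)
  have V: "Vfun_ennreal d H = (\<integral>\<^sup>+x. ennreal (?f x) \<partial>lborel)"
    unfolding Vfun_ennreal_def by (intro nn_integral_cong) (auto simp: indicator_def)
  show "Vfun d H = (LINT x:{0..}|lborel. x ^ (d - 1) * (H x)\<^sup>2)"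
    unfolding Vfun_def V set_lebesgue_integral_def using f nonneg
    by (subst integral_eq_nn_integral) auto
  show "Vfun_ennreal d H < \<infinity> \<longleftrightarrow> set_integrable lborel {0..} (\<lambda>x. x ^ (d - 1) * (H x)\<^sup>2)"
    unfolding V set_integrable_def integrable_iff_bounded using f nonneg by simp
qed

lemma set_integrable_imp_set_borel_measurable:
  "set_integrable M A f \<Longrightarrow> set_borel_measurable M A f"
  unfolding set_integrable_def set_borel_measurable_def by (rule borel_measurable_integrable)

text \<open>If the first variation at \<open>g\<close> in the direction of the competitor is nonnegative, convexity of
  the Dirichlet energy gives global minimality.\<close>

lemma Vfun_le_of_first_variation:
  assumes g'1: "\<And>x. x > 1 \<Longrightarrow> g' x = 0" and g': "continuous_on {0..1} g'"
    and H: "set_integrable lborel {0..} H" "Vfun_ennreal d H < \<infinity>"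
    and le: "(LINT x:{0..1}|lborel. x ^ (d - 1) * g' x * g' x)
      \<le> (LINT x:{0..1}|lborel. x ^ (d - 1) * g' x * H x)"
  shows "Vfun d g' \<le> Vfun d H"
proof -
  have H1: "set_integrable lborel {0..1} H"
    by (rule set_integrable_subset[OF H(1)]) auto
  have g'meas: "set_borel_measurable lborel {0..} g'"
  proof -
    have "set_integrable lborel {0..1} g'"
      by (rule borel_integrable_atLeastAtMost'[OF g'])
    then have "set_integrable lborel {0..} g'"
      by (subst set_integral_atLeast_truncate(1)[where g=g']) (use g'1 in auto)
    then show ?thesis
      by (rule set_integrable_imp_set_borel_measurable)
  qed
  have Hm: "set_borel_measurable lborel {0..} H"
    by (rule set_integrable_imp_set_borel_measurable[OF H(1)])
  have HH: "set_integrable lborel {0..} (\<lambda>x. x ^ (d - 1) * (H x)\<^sup>2)"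
    using Vfun_eq_set_integral(2)[OF Hm] H(2) by blast
  have gg: "set_integrable lborel {0..1} (\<lambda>x. x ^ (d - 1) * g' x * g' x)"
    by (intro borel_integrable_atLeastAtMost' continuous_intros g')
  have gH: "set_integrable lborel {0..1} (\<lambda>x. x ^ (d - 1) * g' x * H x)"
    by (intro continuous_mult_set_integrable[OF _ H1] continuous_intros g')
  have Vg: "Vfun d g' = (LINT x:{0..1}|lborel. x ^ (d - 1) * g' x * g' x)"
    unfolding Vfun_eq_set_integral(1)[OF g'meas]
    by (rule set_integral_atLeast_truncate(2)) (use g'1 in \<open>auto simp: power2_eq_square\<close>)
  \<comment> \<open>As a function of \<open>H x\<close>, \<open>?h x\<close> is the tangent to
    \<open>x ^ (d - 1) * (H x)\<^sup>2\<close> at \<open>g' x\<close>; the gap is the weighted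
    square of \<open>H x - g' x\<close>. By \<open>le\<close> the integral of \<open>?h\<close> is
    at least \<open>Vfun d g'\<close>.\<close>
  let ?h = "\<lambda>x. 2 * (x ^ (d - 1) * g' x * H x) - x ^ (d - 1) * g' x * g' x"
  have h: "set_integrable lborel {0..1} ?h"
    using gg gH by (intro set_integral_diff set_integrable_mult_right) auto
  have "Vfun d g' \<le> 2 * (LINT x:{0..1}|lborel. x ^ (d - 1) * g' x * H x) - Vfun d g'"
    using le Vg by linarith
  also have "\<dots> = (LINT x:{0..1}|lborel. ?h x)"
    unfolding Vg by (subst set_integral_diff) (use gg gH in auto)
  also have "\<dots> = (LINT x:{0..}|lborel. if x \<le> 1 then ?h x else 0)"
    by (rule set_integral_atLeast_truncate(2)[symmetric]) auto
  also have "\<dots> \<le> (LINT x:{0..}|lborel. x ^ (d - 1) * (H x)\<^sup>2)"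
  proof (intro set_integral_mono HH)
    show "set_integrable lborel {0..} (\<lambda>x. if x \<le> 1 then ?h x else 0)"
      by (subst set_integral_atLeast_truncate(1)[where g="?h"]) (use h in auto)
    fix x :: real assume x: "x \<in> {0..}"
    have "0 \<le> x ^ (d - 1) * (H x - g' x)\<^sup>2"
      using x by simp
    also have "\<dots> = x ^ (d - 1) * (H x)\<^sup>2 - ?h x"
      by (simp add: power2_eq_square algebra_simps)
    finally show "(if x \<le> 1 then ?h x else 0) \<le> x ^ (d - 1) * (H x)\<^sup>2"
      using x by auto
  qed
  also have "\<dots> = Vfun d H"
    by (rule Vfun_eq_set_integral(1)[OF Hm, symmetric])
  finally show ?thesis .
qed

section \<open>Truncated polynomial kernels\<close>

text \<open>One family for both orders: up to the scale \<open>C\<close>, the parameters 1 and 0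
  give q = 2, while d + 2 and d + 8 give q = 4. The only cut is at 1, so the even polynomial
  continues to negative arguments and the derivative at 0 is two-sided.\<close>

definition bump :: "real \<Rightarrow> real \<Rightarrow> real \<Rightarrow> real \<Rightarrow> real" where
  "bump C A B x = (if x \<le> 1 then C * (1 - x\<^sup>2)\<^sup>2 * (A - B * x\<^sup>2) else 0)"

definition bump' :: "real \<Rightarrow> real \<Rightarrow> real \<Rightarrow> real \<Rightarrow> real" where
  "bump' C A B x = (if x \<le> 1 then - 2 * C * x * (1 - x\<^sup>2) * (2 * A + B - 3 * B * x\<^sup>2) else 0)"

text \<open>The negative radial Laplacian of \<open>bump C A B\<close> in dimension \<open>d\<close>, continued as a
  polynomial beyond the support.\<close>

definition bump_laplacian :: "nat \<Rightarrow> real \<Rightarrow> real \<Rightarrow> real \<Rightarrow> real \<Rightarrow> real" where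
  "bump_laplacian d C A B x =
     2 * C * (d * (2 * A + B) - (d + 2) * (2 * A + 4 * B) * x\<^sup>2 + 3 * (d + 4) * B * x ^ 4)"

lemma bump_has_real_derivative: "(bump C A B has_real_derivative bump' C A B x) (at x)"
proof -
  define p where "p = (\<lambda>x::real. C * (1 - x\<^sup>2)\<^sup>2 * (A - B * x\<^sup>2))"
  define p' where "p' = (\<lambda>x::real. - 2 * C * x * (1 - x\<^sup>2) * (2 * A + B - 3 * B * x\<^sup>2))"
  have p: "(p has_real_derivative p' y) (at y within S)" for y S
    unfolding p_def p'_def
    by (rule derivative_eq_intros refl | simp)+ (simp add: algebra_simps power2_eq_square)
  consider "x < 1" | "x > 1" | "x = 1" by linarith
  then show ?thesis
  proof cases
    case 1
    have "(bump C A B has_real_derivative p' x) (at x)"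
      by (rule has_field_derivative_transform_within_open[OF p, where S="{..<1}"])
         (use 1 in \<open>auto simp: bump_def p_def\<close>)
    then show ?thesis using 1 by (simp add: bump'_def p'_def)
  next
    case 2
    have "(bump C A B has_real_derivative 0) (at x)"
      by (rule has_field_derivative_transform_within_open[of "\<lambda>_. 0" 0 x "{1<..}"])
         (use 2 in \<open>auto simp: bump_def\<close>)
    then show ?thesis using 2 by (simp add: bump'_def)
  next
    case 3
    \<comment> \<open>At the edge of the support both one-sided derivatives vanish, since
      \<open>p'\<close> contains the factor 1 - x^2; they are then glued together.\<close>
    have "(bump C A B has_real_derivative 0) (at 1 within {..1})"
      by (rule has_field_derivative_transform_within[of p 0 1 "{..1}" 1])
         (use p[of 1 "{..1}"] in \<open>auto simp: bump_def p_def p'_def\<close>)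
    then have l: "(bump C A B has_real_derivative 0) (at_left 1)"
      by (rule DERIV_subset) auto
    have "(bump C A B has_real_derivative 0) (at 1 within {1..})"
      by (rule has_field_derivative_transform_within[of "\<lambda>_. 0" 0 1 "{1..}" 1])
         (auto simp: bump_def)
    then have "(bump C A B has_real_derivative 0) (at_right 1)"
      by (rule DERIV_subset) auto
    with l have "(bump C A B has_real_derivative 0) (at 1)"
      unfolding has_field_derivative_iff by (rule filterlim_split_at)
    then show ?thesis using 3 by (simp add: bump'_def)
  qed
qed

lemma continuous_on_bump': "continuous_on {0..1} (bump' C A B)"
proof -
  have "continuous_on {0..1} (\<lambda>x::real. - 2 * C * x * (1 - x\<^sup>2) * (2 * A + B - 3 * B * x\<^sup>2))"
    by (intro continuous_intros)
  then show ?thesis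
    by (rule continuous_on_eq) (simp add: bump'_def)
qed

lemma set_integrable_bump': "set_integrable lborel {0..} (bump' C A B)"
  by (subst set_integral_atLeast_truncate(1)[where g="bump' C A B"])
     (auto simp: bump'_def[of _ _ _ x for x] intro!: borel_integrable_atLeastAtMost' continuous_on_bump')

lemma Vfun_bump'_finite: "Vfun_ennreal d (bump' C A B) < \<infinity>"
proof -
  have "set_integrable lborel {0..1} (\<lambda>x. x ^ (d - 1) * (bump' C A B x)\<^sup>2)"
    by (intro borel_integrable_atLeastAtMost' continuous_intros continuous_on_bump')
  then have "set_integrable lborel {0..} (\<lambda>x. x ^ (d - 1) * (bump' C A B x)\<^sup>2)"
    by (subst set_integral_atLeast_truncate(1)[where g="\<lambda>x. x ^ (d - 1) * (bump' C A B x)\<^sup>2"])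
       (auto simp: bump'_def)
  then show ?thesis
    using Vfun_eq_set_integral(2)[OF set_integrable_imp_set_borel_measurable[OF set_integrable_bump']]
    by blast
qed

section \<open>Moments of the kernels and pairings with polynomial weights\<close>

lemma bump_moment:
  shows "set_integrable lborel {0..} (\<lambda>x. x ^ n * bump C A B x)"
    and "(LINT x:{0..}|lborel. x ^ n * bump C A B x) =
      C * (A / (real n + 1) - (2 * A + B) / (real n + 3) + (A + 2 * B) / (real n + 5) - B / (real n + 7))"
proof -
  define f where "f = (\<lambda>x::real. x ^ n * (C * (1 - x\<^sup>2)\<^sup>2 * (A - B * x\<^sup>2)))"
  \<comment> \<open>Termwise antiderivative of the expansion (1 - t)^2 (A - B t) = A - (2A + B) t +
    (A + 2B) t^2 - B t^3 with t = x^2.\<close>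
  define F where "F = (\<lambda>x::real. C * (A / (n + 1) * x ^ (n + 1) - (2 * A + B) / (n + 3) * x ^ (n + 3)
      + (A + 2 * B) / (n + 5) * x ^ (n + 5) - B / (n + 7) * x ^ (n + 7)))"
  have tr: "x ^ n * bump C A B x = (if x \<le> 1 then f x else 0)" for x
    by (simp add: bump_def f_def)
  have f: "set_integrable lborel {0..1} f"
    unfolding f_def by (intro borel_integrable_atLeastAtMost' continuous_intros)
  then show "set_integrable lborel {0..} (\<lambda>x. x ^ n * bump C A B x)"
    by (subst set_integral_atLeast_truncate(1)[where g=f]) (auto simp: tr)
  have pow: "((\<lambda>x. c / real (Suc k) * x ^ Suc k) has_real_derivative c * x ^ k) (at x within S)"
    for c k and x :: real and S
    by (rule derivative_eq_intros refl | simp)+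
  have "(F has_real_derivative
      C * (A * x ^ n - (2 * A + B) * x ^ (n + 2) + (A + 2 * B) * x ^ (n + 4) - B * x ^ (n + 6)))
      (at x within {0..1})" for x
    using pow[of A n x] pow[of "2 * A + B" "n + 2" x] pow[of "A + 2 * B" "n + 4" x] pow[of B "n + 6" x]
    unfolding F_def
    by (intro DERIV_cmult DERIV_add DERIV_diff) (simp_all add: eval_nat_numeral add_ac)
  moreover have "C * (A * x ^ n - (2 * A + B) * x ^ (n + 2) + (A + 2 * B) * x ^ (n + 4) - B * x ^ (n + 6))
      = f x" for x
    by (simp add: f_def power_add eval_nat_numeral algebra_simps)
  ultimately have "(f has_integral F 1 - F 0) {0..1}"
    by (intro fundamental_theorem_of_calculus)
       (simp_all add: has_real_derivative_iff_has_vector_derivative[symmetric])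
  then have "(LINT x:{0..1}|lborel. f x) = F 1 - F 0"
    using set_borel_integral_eq_integral(2)[OF f] by (simp add: integral_unique)
  moreover have "(LINT x:{0..}|lborel. x ^ n * bump C A B x) = (LINT x:{0..1}|lborel. f x)"
    by (rule set_integral_atLeast_truncate(2)) (simp add: tr)
  ultimately show "(LINT x:{0..}|lborel. x ^ n * bump C A B x) =
      C * (A / (real n + 1) - (2 * A + B) / (real n + 3) + (A + 2 * B) / (real n + 5) - B / (real n + 7))"
    by (simp add: F_def power_0_left)
qed

lemma Bmom_bump:
  assumes "d \<ge> 1"
  shows "Bmom_exists d i (bump C A B)"
    and "Bmom d i (bump C A B) = C * (A / (real d + i) - (2 * A + B) / (real d + i + 2)
      + (A + 2 * B) / (real d + i + 4) - B / (real d + i + 6))"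
proof -
  show "Bmom_exists d i (bump C A B)"
    unfolding Bmom_exists_def by (rule bump_moment(1))
  have "real (d - 1 + i) + 1 = real d + i" "real (d - 1 + i) + 3 = real d + i + 2"
    "real (d - 1 + i) + 5 = real d + i + 4" "real (d - 1 + i) + 7 = real d + i + 6"
    using assms by (simp_all add: of_nat_diff)
  then show "Bmom d i (bump C A B) = C * (A / (real d + i) - (2 * A + B) / (real d + i + 2)
      + (A + 2 * B) / (real d + i + 4) - B / (real d + i + 6))"
    unfolding Bmom_def bump_moment(2) by (simp only:)
qed

text \<open>Conditional existence of the fourth moment lets the case q = 2, where only the moments
  up to order 2 are known to exist, use the same formula with \<open>k2 = 0\<close>.\<close>

lemma set_integral_weight_moments:
  assumes "Bmom_exists d 0 G" and "Bmom_exists d 2 G" and "k2 \<noteq> 0 \<Longrightarrow> Bmom_exists d 4 G"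
  shows "set_integrable lborel {0..} (\<lambda>x. x ^ (d - 1) * (k0 + k1 * x\<^sup>2 + k2 * x ^ 4) * G x)"
    and "(LINT x:{0..}|lborel. x ^ (d - 1) * (k0 + k1 * x\<^sup>2 + k2 * x ^ 4) * G x) =
      k0 * Bmom d 0 G + k1 * Bmom d 2 G + k2 * Bmom d 4 G"
proof -
  have eq: "x ^ (d - 1) * (k0 + k1 * x\<^sup>2 + k2 * x ^ 4) * G x = k0 * (x ^ (d - 1 + 0) * G x)
      + k1 * (x ^ (d - 1 + 2) * G x) + k2 * (x ^ (d - 1 + 4) * G x)" for x
    by (simp add: power_add power2_eq_square algebra_simps)
  have 0: "set_integrable lborel {0..} (\<lambda>x. k0 * (x ^ (d - 1 + 0) * G x))"
    and 1: "set_integrable lborel {0..} (\<lambda>x. k1 * (x ^ (d - 1 + 2) * G x))"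
    and 2: "set_integrable lborel {0..} (\<lambda>x. k2 * (x ^ (d - 1 + 4) * G x))"
    using assms unfolding Bmom_exists_def by (intro set_integrable_mult_right; blast)+
  show "set_integrable lborel {0..} (\<lambda>x. x ^ (d - 1) * (k0 + k1 * x\<^sup>2 + k2 * x ^ 4) * G x)"
    unfolding eq by (intro set_integral_add(1) 0 1 2)
  show "(LINT x:{0..}|lborel. x ^ (d - 1) * (k0 + k1 * x\<^sup>2 + k2 * x ^ 4) * G x) =
      k0 * Bmom d 0 G + k1 * Bmom d 2 G + k2 * Bmom d 4 G"
    unfolding eq Bmom_def
    unfolding set_integral_add(2)[OF set_integral_add(1)[OF 0 1] 2] set_integral_add(2)[OF 0 1]
    by simp
qed

text \<open>The boundary terms vanish whatever values \<open>G\<close> takes at 0 and 1: x^(d-1)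
  times the kernel derivative has a factor x, even for d = 1, and a factor 1 - x^2.\<close>

lemma bump_integration_by_parts:
  assumes "d \<ge> 1" and G: "\<And>x. x \<ge> 0 \<Longrightarrow> (G has_real_derivative H x) (at x within {0..})"
    and H: "set_integrable lborel {0..} H"
  shows "(LINT x:{0..1}|lborel. x ^ (d - 1) * bump' C A B x * H x) =
    (LINT x:{0..1}|lborel. x ^ (d - 1) * bump_laplacian d C A B x * G x)"
proof -
  obtain k where d: "d = Suc k" using assms(1) by (cases d) auto
  define \<phi> where "\<phi> = (\<lambda>x::real. - 2 * C * ((2 * A + B) * x ^ (k + 1)
      - (2 * A + 4 * B) * x ^ (k + 3) + 3 * B * x ^ (k + 5)))"
  have \<phi>': "(\<phi> has_real_derivative - (x ^ (d - 1) * bump_laplacian d C A B x)) (at x within S)" for x S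
    unfolding \<phi>_def d bump_laplacian_def
    by (rule derivative_eq_intros refl | simp)+
       (simp add: power_add eval_nat_numeral algebra_simps)
  have \<phi>: "x ^ (d - 1) * bump' C A B x = \<phi> x" if "x \<in> {0..1}" for x
    using that by (simp add: \<phi>_def d bump'_def power_add eval_nat_numeral algebra_simps)
  have "(LINT x:{0..1}|lborel. x ^ (d - 1) * bump' C A B x * H x) = (LINT x:{0..1}|lborel. \<phi> x * H x)"
    using \<phi> by (intro set_lebesgue_integral_cong) simp_all
  also have "\<dots> = - (LINT x:{0..1}|lborel. - (x ^ (d - 1) * bump_laplacian d C A B x) * G x)"
  proof (rule integration_by_parts_vanishing_boundary)
    show "continuous_on {0..1} (\<lambda>x. - (x ^ (d - 1) * bump_laplacian d C A B x))"
      unfolding bump_laplacian_def by (intro continuous_intros)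
    show "\<phi> 0 = 0" "\<phi> 1 = 0" by (simp_all add: \<phi>_def power_0_left)
    show "(G has_real_derivative H x) (at x within {0..1})" if "x \<in> {0..1}" for x
      by (rule DERIV_subset[OF G]) (use that in auto)
    show "set_integrable lborel {0..1} H"
      by (rule set_integrable_subset[OF H]) auto
  qed (use \<phi>' in auto)
  also have "\<dots> = (LINT x:{0..1}|lborel. x ^ (d - 1) * bump_laplacian d C A B x * G x)"
    by (simp add: set_lebesgue_integral_def)
  finally show ?thesis .
qed

text \<open>Reduces minimality to the choice of a weight \<open>K\<close>: its integral against
  \<open>G\<close> should be computable from the moments, while pointwise, against \<open>G\<close>,
  it stays below the truncated Laplacian. Integration by parts is applied twice, to the kernel
  itself and to \<open>G\<close>.\<close>

lemma Vfun_bump'_le: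
  assumes d: "d \<ge> 1" and G: "\<And>x. x \<ge> 0 \<Longrightarrow> (G has_real_derivative H x) (at x within {0..})"
    and H: "set_integrable lborel {0..} H" "Vfun_ennreal d H < \<infinity>"
    and K: "set_integrable lborel {0..} (\<lambda>x. x ^ (d - 1) * K x * G x)"
    and le: "\<And>x. x \<ge> 0 \<Longrightarrow> K x * G x \<le> (if x \<le> 1 then bump_laplacian d C A B x * G x else 0)"
    and eq: "(LINT x:{0..}|lborel. x ^ (d - 1) * bump_laplacian d C A B x * bump C A B x)
      \<le> (LINT x:{0..}|lborel. x ^ (d - 1) * K x * G x)"
  shows "Vfun d (bump' C A B) \<le> Vfun d H"
proof (rule Vfun_le_of_first_variation[OF _ continuous_on_bump' H])
  show "bump' C A B x = 0" if "x > 1" for x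
    using that by (simp add: bump'_def)
  have G1: "continuous_on {0..1} G"
    using G DERIV_subset[OF G, of _ "{0..1}"]
    by (intro DERIV_continuous_on[where D=H]) auto
  have int: "set_integrable lborel {0..1} (\<lambda>x. x ^ (d - 1) * bump_laplacian d C A B x * G x)"
    unfolding bump_laplacian_def by (intro borel_integrable_atLeastAtMost' continuous_intros G1)
  have "(LINT x:{0..1}|lborel. x ^ (d - 1) * bump' C A B x * bump' C A B x) =
      (LINT x:{0..1}|lborel. x ^ (d - 1) * bump_laplacian d C A B x * bump C A B x)"
    by (intro bump_integration_by_parts d set_integrable_bump'
        has_field_derivative_at_within[OF bump_has_real_derivative])
  \<comment> \<open>The kernel vanishes beyond 1, so its pairing extends to the half line, where it
    is a combination of moments.\<close>
  also have "\<dots> = (LINT x:{0..}|lborel. x ^ (d - 1) * bump_laplacian d C A B x * bump C A B x)"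
    by (rule set_integral_atLeast_truncate(2)[symmetric]) (auto simp: bump_def)
  also note eq
  also have "(LINT x:{0..}|lborel. x ^ (d - 1) * K x * G x) \<le> (LINT x:{0..}|lborel.
      if x \<le> 1 then x ^ (d - 1) * bump_laplacian d C A B x * G x else 0)"
  proof (intro set_integral_mono K)
    show "set_integrable lborel {0..}
        (\<lambda>x. if x \<le> 1 then x ^ (d - 1) * bump_laplacian d C A B x * G x else 0)"
      by (subst set_integral_atLeast_truncate(1)[where
            g="\<lambda>x. x ^ (d - 1) * bump_laplacian d C A B x * G x"]) (use int in auto)
    fix x :: real assume x: "x \<in> {0..}"
    have "x ^ (d - 1) * (K x * G x)
        \<le> x ^ (d - 1) * (if x \<le> 1 then bump_laplacian d C A B x * G x else 0)"
      using x le by (intro mult_left_mono) auto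
    then show "x ^ (d - 1) * K x * G x
        \<le> (if x \<le> 1 then x ^ (d - 1) * bump_laplacian d C A B x * G x else 0)"
      by (auto simp: mult.assoc split: if_splits)
  qed
  also have "\<dots> = (LINT x:{0..1}|lborel. x ^ (d - 1) * bump_laplacian d C A B x * G x)"
    by (rule set_integral_atLeast_truncate(2)) auto
  also have "\<dots> = (LINT x:{0..1}|lborel. x ^ (d - 1) * bump' C A B x * H x)"
    by (intro bump_integration_by_parts[symmetric] d G H)
  finally show "(LINT x:{0..1}|lborel. x ^ (d - 1) * bump' C A B x * bump' C A B x)
      \<le> (LINT x:{0..1}|lborel. x ^ (d - 1) * bump' C A B x * H x)" .
qed

section \<open>Comparison of Dirichlet energies\<close>

text \<open>The factor \<open>L ^ d\<close> preserves the zeroth moment, and vanishing moments stay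
  zero. In the objective the factor L^(-q) of the moment, to the power 2(d+2), cancels the factor
  L^(d+2) of the energy, to the power 2q.\<close>

lemma scaled_profile:
  assumes L: "L > 0" and d: "d \<ge> 1"
  shows "Bmom_exists d i G \<Longrightarrow> Bmom_exists d i (\<lambda>x. L ^ d * G (L * x))"
    and "Bmom d i (\<lambda>x. L ^ d * G (L * x)) = Bmom d i G / L ^ i"
    and "(\<And>x. x \<ge> 0 \<Longrightarrow> (G has_real_derivative H x) (at x within {0..})) \<Longrightarrow> y \<ge> 0 \<Longrightarrow>
      ((\<lambda>x. L ^ d * G (L * x)) has_real_derivative L ^ (d + 1) * H (L * y)) (at y within {0..})"
    and "set_integrable lborel {0..} H \<Longrightarrow> set_integrable lborel {0..} (\<lambda>x. L ^ (d + 1) * H (L * x))"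
    and "set_integrable lborel {0..} H \<Longrightarrow> Vfun_ennreal d H < \<infinity> \<Longrightarrow>
      Vfun_ennreal d (\<lambda>x. L ^ (d + 1) * H (L * x)) < \<infinity>"
    and "set_integrable lborel {0..} H \<Longrightarrow>
      Vfun d (\<lambda>x. L ^ (d + 1) * H (L * x)) = L ^ (d + 2) * Vfun d H"
proof -
  obtain k where k: "d = Suc k" using d by (cases d) auto
  have B: "x ^ (d - 1 + i) * (L ^ d * G (L * x)) = L / L ^ i * ((L * x) ^ (d - 1 + i) * G (L * x))" for x
    using L by (simp add: k power_mult_distrib power_add field_simps)
  show "Bmom_exists d i G \<Longrightarrow> Bmom_exists d i (\<lambda>x. L ^ d * G (L * x))"
    unfolding Bmom_exists_def B
    using set_integral_atLeast_scale(1)[OF L, of "\<lambda>y. y ^ (d - 1 + i) * G y"] by simp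
  show "Bmom d i (\<lambda>x. L ^ d * G (L * x)) = Bmom d i G / L ^ i"
    unfolding Bmom_def B set_integral_mult_right
    unfolding set_integral_atLeast_scale(2)[OF L, of "\<lambda>y. y ^ (d - 1 + i) * G y"]
    using L by simp
  show "((\<lambda>x. L ^ d * G (L * x)) has_real_derivative L ^ (d + 1) * H (L * y)) (at y within {0..})"
    if G: "\<And>x. x \<ge> 0 \<Longrightarrow> (G has_real_derivative H x) (at x within {0..})" and y: "y \<ge> 0"
  proof -
    have "(*) L ` {0..} \<subseteq> {0..}" using L by auto
    then have "(G has_real_derivative H (L * y)) (at (L * y) within (*) L ` {0..})"
      using DERIV_subset[OF G] L y by simp
    moreover have "((*) L has_real_derivative L) (at y within {0..})"
      by (auto intro!: derivative_eq_intros)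
    ultimately have "(G \<circ> (*) L has_real_derivative H (L * y) * L) (at y within {0..})"
      by (rule DERIV_image_chain)
    from DERIV_cmult[OF this, of "L ^ d"] show ?thesis
      by (simp add: o_def mult_ac)
  qed
  show H2: "set_integrable lborel {0..} (\<lambda>x. L ^ (d + 1) * H (L * x))"
    if "set_integrable lborel {0..} H"
    using that set_integral_atLeast_scale(1)[OF L, of H] by simp
  have V: "x ^ (d - 1) * (L ^ (d + 1) * H (L * x))\<^sup>2 =
      L ^ (d + 3) * ((L * x) ^ (d - 1) * (H (L * x))\<^sup>2)" for x
    by (simp add: k power_mult_distrib power_add eval_nat_numeral algebra_simps)
  show "Vfun_ennreal d (\<lambda>x. L ^ (d + 1) * H (L * x)) < \<infinity>"
    if H: "set_integrable lborel {0..} H" and "Vfun_ennreal d H < \<infinity>"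
  proof -
    have "set_integrable lborel {0..} (\<lambda>x. x ^ (d - 1) * (H x)\<^sup>2)"
      using Vfun_eq_set_integral(2)[OF set_integrable_imp_set_borel_measurable[OF H]] that by blast
    then show ?thesis
      unfolding Vfun_eq_set_integral(2)[OF set_integrable_imp_set_borel_measurable[OF H2[OF H]]] V
      using set_integral_atLeast_scale(1)[OF L, of "\<lambda>x. x ^ (d - 1) * (H x)\<^sup>2"] by simp
  qed
  show "Vfun d (\<lambda>x. L ^ (d + 1) * H (L * x)) = L ^ (d + 2) * Vfun d H"
    if H: "set_integrable lborel {0..} H"
    unfolding Vfun_eq_set_integral(1)[OF set_integrable_imp_set_borel_measurable[OF H]]
      Vfun_eq_set_integral(1)[OF set_integrable_imp_set_borel_measurable[OF H2[OF H]]] V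
      set_integral_mult_right
    unfolding set_integral_atLeast_scale(2)[OF L, of "\<lambda>x. x ^ (d - 1) * (H x)\<^sup>2"]
    using L by (simp add: power_add eval_nat_numeral)
qed

text \<open>The case q = 2. The weight is the Laplacian 4C(d - (d + 2)x^2) itself: it is nonpositive
  beyond 1, so extending its integral against a nonnegative \<open>G\<close> to the half line can
  only decrease it.\<close>

lemma Vfun_bump'_le_nonneg:
  assumes d: "d \<ge> 1" and C: "C \<ge> 0"
    and G: "\<And>x. x \<ge> 0 \<Longrightarrow> (G has_real_derivative H x) (at x within {0..})"
    and H: "set_integrable lborel {0..} H" "Vfun_ennreal d H < \<infinity>"
    and ex: "Bmom_exists d 0 G" "Bmom_exists d 2 G"
    and mom: "Bmom d 0 G = Bmom d 0 (bump C 1 0)" "Bmom d 2 G = Bmom d 2 (bump C 1 0)"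
    and nonneg: "\<And>x. x \<ge> 0 \<Longrightarrow> G x \<ge> 0"
  shows "Vfun d (bump' C 1 0) \<le> Vfun d H"
proof -
  have lap: "bump_laplacian d C 1 0 x = 4 * C * d + (- 4 * C * (d + 2)) * x\<^sup>2 + 0 * x ^ 4" for x
    by (simp add: bump_laplacian_def algebra_simps)
  show ?thesis
  proof (rule Vfun_bump'_le[OF d G H, where K="bump_laplacian d C 1 0"])
    show "set_integrable lborel {0..} (\<lambda>x. x ^ (d - 1) * bump_laplacian d C 1 0 x * G x)"
      unfolding lap by (rule set_integral_weight_moments(1)) (use ex in auto)
    show "(LINT x:{0..}|lborel. x ^ (d - 1) * bump_laplacian d C 1 0 x * bump C 1 0 x)
        \<le> (LINT x:{0..}|lborel. x ^ (d - 1) * bump_laplacian d C 1 0 x * G x)"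
      unfolding lap
      by (subst (1 2) set_integral_weight_moments(2)) (use ex mom Bmom_bump(1)[OF d] in auto)
    show "bump_laplacian d C 1 0 x * G x \<le> (if x \<le> 1 then bump_laplacian d C 1 0 x * G x else 0)"
      if x: "x \<ge> 0" for x
    proof (cases "x \<le> 1")
      case False
      then have "x\<^sup>2 \<ge> 1" by (simp add: one_le_power)
      then have "real d * 1 \<le> (d + 2) * x\<^sup>2" by (intro mult_mono) auto
      then have "C * (d - (d + 2) * x\<^sup>2) \<le> 0"
        using C by (intro mult_nonneg_nonpos) auto
      then have "bump_laplacian d C 1 0 x \<le> 0" unfolding lap by (simp add: algebra_simps)
      then show ?thesis
        using False nonneg[OF x] by (simp add: mult_nonpos_nonneg)
    qed simp
  qed
qed

text \<open>Subtracting \<open>\<kappa> t\<close> is free because the second moment vanishes.  For \<open>\<sigma> > 1\<close> it is chosen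
  so that \<open>Q t - \<kappa> t\<close> vanishes exactly at the sign change \<open>\<sigma>\<close> within \<open>{1..}\<close>.\<close>

lemma laplacian_correction:
  fixes d \<sigma> t :: real
  defines "Q \<equiv> \<lambda>t. d * (d + 4) - 2 * (d + 2) * (d + 6) * t + (d + 4) * (d + 8) * t\<^sup>2"
  defines "\<kappa> \<equiv> if \<sigma> \<le> 1 then 0 else Q \<sigma> / \<sigma>"
  assumes d: "d \<ge> 0" and t: "t \<ge> 0"
  shows "t \<le> \<sigma> \<Longrightarrow> Q t - \<kappa> * t \<le> (if t \<le> 1 then Q t else 0)"
    and "t \<ge> \<sigma> \<Longrightarrow> Q t - \<kappa> * t \<ge> (if t \<le> 1 then Q t else 0)"
proof -
  have pos: "Q u \<ge> 0" if "u \<ge> 1" for u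
  proof -
    \<comment> \<open>Taylor expansion at 1; all its coefficients are nonnegative.\<close>
    have "Q u = 8 + (8 * d + 40) * (u - 1) + (d + 4) * (d + 8) * (u - 1)\<^sup>2"
      by (simp add: Q_def power2_eq_square algebra_simps)
    then show ?thesis using d that by simp
  qed
  \<comment> \<open>This sign makes subtracting \<open>\<kappa> * t\<close> go the right way on
    [0,1], where only an upper bound by \<open>Q t\<close> is wanted when \<open>\<sigma>\<close>
    lies beyond 1.\<close>
  have \<kappa>: "\<kappa> \<ge> 0" using pos[of \<sigma>] by (simp add: \<kappa>_def)
  \<comment> \<open>By the choice of \<open>\<kappa>\<close> one root is \<open>\<sigma>\<close>;
    the product of the roots is d/(d + 8), so the other root is d/((d + 8) \<sigma>), which lies
    below 1. The sign beyond 1 is therefore that of \<open>\<sigma> - t\<close>, reversed.\<close>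
  have factor: "Q t - \<kappa> * t = (\<sigma> - t) * (d * (d + 4) - (d + 4) * (d + 8) * (t * \<sigma>)) / \<sigma>" if "\<sigma> > 1"
    using that by (simp add: \<kappa>_def Q_def field_simps power2_eq_square)
  have neg: "d * (d + 4) - (d + 4) * (d + 8) * (t * \<sigma>) \<le> 0" if "\<sigma> > 1" "t > 1"
  proof -
    have "1 * 1 \<le> t * \<sigma>" using that by (intro mult_mono) auto
    then have "(d + 4) * d * 1 \<le> (d + 4) * (d + 8) * (t * \<sigma>)" using d by (intro mult_mono) auto
    then show ?thesis by (simp add: mult.commute)
  qed
  show "Q t - \<kappa> * t \<le> (if t \<le> 1 then Q t else 0)" if "t \<le> \<sigma>"
  proof (cases "t \<le> 1")
    case False
    then have "(\<sigma> - t) * (d * (d + 4) - (d + 4) * (d + 8) * (t * \<sigma>)) / \<sigma> \<le> 0"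
      using that neg by (intro divide_nonpos_pos mult_nonneg_nonpos) auto
    then show ?thesis using False that factor by simp
  qed (use \<kappa> t in simp)
  show "Q t - \<kappa> * t \<ge> (if t \<le> 1 then Q t else 0)" if "t \<ge> \<sigma>"
  proof (cases "\<sigma> \<le> 1")
    case True
    then show ?thesis using pos[of t] by (simp add: \<kappa>_def)
  next
    case False
    then have "(\<sigma> - t) * (d * (d + 4) - (d + 4) * (d + 8) * (t * \<sigma>)) / \<sigma> \<ge> 0"
      using that neg by (intro divide_nonneg_pos mult_nonpos_nonpos) auto
    then show ?thesis using False that factor by simp
  qed
qed

text \<open>The case q = 4. The Laplacian is 6C times the quadratic of
  \<open>laplacian_correction\<close> at x^2. The two inequalities there point in opposite
  directions on the two sides of \<open>s\<close>, as do the signs of \<open>G\<close>, so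
  multiplication by \<open>G\<close> yields one inequality throughout.\<close>

lemma Vfun_bump'_le_one_sign_change:
  assumes d: "d \<ge> 1" and C: "C \<ge> 0" and s: "s > 0"
    and G: "\<And>x. x \<ge> 0 \<Longrightarrow> (G has_real_derivative H x) (at x within {0..})"
    and H: "set_integrable lborel {0..} H" "Vfun_ennreal d H < \<infinity>"
    and ex: "Bmom_exists d 0 G" "Bmom_exists d 2 G" "Bmom_exists d 4 G"
    and mom: "Bmom d 0 G = Bmom d 0 (bump C (real d + 2) (real d + 8))" "Bmom d 2 G = 0"
      "Bmom d 2 (bump C (real d + 2) (real d + 8)) = 0" "Bmom d 4 G = Bmom d 4 (bump C (real d + 2) (real d + 8))"
    and nonneg: "\<And>x. 0 \<le> x \<Longrightarrow> x \<le> s \<Longrightarrow> G x \<ge> 0"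
    and nonpos: "\<And>x. x \<ge> s \<Longrightarrow> G x \<le> 0"
  shows "Vfun d (bump' C (real d + 2) (real d + 8)) \<le> Vfun d H"
proof -
  define Q :: "real \<Rightarrow> real" where
    "Q = (\<lambda>t. real d * (real d + 4) - 2 * (real d + 2) * (real d + 6) * t + (real d + 4) * (real d + 8) * t\<^sup>2)"
  define \<kappa> where "\<kappa> = (if s\<^sup>2 \<le> 1 then 0 else Q (s\<^sup>2) / s\<^sup>2)"
  define K where "K = (\<lambda>x. 6 * C * (Q (x\<^sup>2) - \<kappa> * x\<^sup>2))"
  have lapQ: "bump_laplacian d C (real d + 2) (real d + 8) x = 6 * C * Q (x\<^sup>2)" for x
    by (simp add: bump_laplacian_def Q_def algebra_simps power2_eq_square eval_nat_numeral)
  have lap: "bump_laplacian d C (real d + 2) (real d + 8) x = 6 * C * (real d * (real d + 4))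
      + (- 12 * C * (real d + 2) * (real d + 6)) * x\<^sup>2 + 6 * C * (real d + 4) * (real d + 8) * x ^ 4" for x
    unfolding lapQ Q_def by (simp add: algebra_simps)
  have K: "K x = 6 * C * (real d * (real d + 4))
      + (- 12 * C * (real d + 2) * (real d + 6) - 6 * C * \<kappa>) * x\<^sup>2 + 6 * C * (real d + 4) * (real d + 8) * x ^ 4" for x
    unfolding K_def Q_def by (simp add: algebra_simps)
  show ?thesis
  proof (rule Vfun_bump'_le[OF d G H, where K=K])
    show "set_integrable lborel {0..} (\<lambda>x. x ^ (d - 1) * K x * G x)"
      unfolding K by (rule set_integral_weight_moments(1)) (use ex in auto)
    show "(LINT x:{0..}|lborel. x ^ (d - 1) * bump_laplacian d C (real d + 2) (real d + 8) x * bump C (real d + 2) (real d + 8) x)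
        \<le> (LINT x:{0..}|lborel. x ^ (d - 1) * K x * G x)"
      unfolding lap K
      by (subst (1 2) set_integral_weight_moments(2)) (use ex mom Bmom_bump(1)[OF d] in auto)
    fix x :: real assume x: "x \<ge> 0"
    have sq: "x\<^sup>2 \<le> 1 \<longleftrightarrow> x \<le> 1" using x by (simp add: power_le_one_iff)
    have le: "Q (x\<^sup>2) - \<kappa> * x\<^sup>2 \<le> (if x \<le> 1 then Q (x\<^sup>2) else 0)" if "x \<le> s"
      using laplacian_correction(1)[of "real d" "x\<^sup>2" "s\<^sup>2"] x that
      unfolding Q_def \<kappa>_def sq by (simp add: power_mono)
    have ge: "Q (x\<^sup>2) - \<kappa> * x\<^sup>2 \<ge> (if x \<le> 1 then Q (x\<^sup>2) else 0)" if "x \<ge> s"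
      using laplacian_correction(2)[of "real d" "x\<^sup>2" "s\<^sup>2"] x s that
      unfolding Q_def \<kappa>_def sq by (simp add: power_mono)
    have "(Q (x\<^sup>2) - \<kappa> * x\<^sup>2) * G x \<le> (if x \<le> 1 then Q (x\<^sup>2) else 0) * G x"
    proof (cases "x \<le> s")
      case True
      then show ?thesis using le nonneg x by (intro mult_right_mono) auto
    next
      case False
      then show ?thesis using ge nonpos by (intro mult_right_mono_neg) auto
    qed
    then have "6 * C * ((Q (x\<^sup>2) - \<kappa> * x\<^sup>2) * G x) \<le> 6 * C * ((if x \<le> 1 then Q (x\<^sup>2) else 0) * G x)"
      using C by (intro mult_left_mono) auto
    then show "K x * G x \<le> (if x \<le> 1 then bump_laplacian d C (real d + 2) (real d + 8) x * G x else 0)"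
      unfolding K_def lapQ by (auto simp: mult_ac split: if_splits)
  qed
qed

section \<open>Sign changes and the signs of moments\<close>

lemma Bmom_nonneg: "(\<And>x. x \<ge> 0 \<Longrightarrow> G x \<ge> 0) \<Longrightarrow> Bmom d i G \<ge> 0"
  unfolding Bmom_def by (rule set_integral_nonneg_real) auto

lemma Bmom_uminus: "Bmom d i (\<lambda>x. - G x) = - Bmom d i G"
  unfolding Bmom_def by (simp add: set_lebesgue_integral_def)

text \<open>The factor x^2 - s^2 changes sign at \<open>s\<close> in the opposite sense to
  \<open>G\<close>, so their product is nonpositive. This serves both to exclude the wrong sign
  pattern and to find the sign of the fourth moment.\<close>

lemma Bmom_sign_change_le:
  assumes ex: "Bmom_exists d i G" "Bmom_exists d j G" and j: "j = i + 2" and s: "s > 0"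
    and nonneg: "\<And>x. 0 \<le> x \<Longrightarrow> x \<le> s \<Longrightarrow> G x \<ge> 0"
    and nonpos: "\<And>x. x \<ge> s \<Longrightarrow> G x \<le> 0"
  shows "Bmom d j G \<le> s\<^sup>2 * Bmom d i G"
proof -
  have "Bmom d j G \<le> (LINT x:{0..}|lborel. s\<^sup>2 * (x ^ (d - 1 + i) * G x))"
    unfolding Bmom_def
  proof (rule set_integral_mono)
    show "set_integrable lborel {0..} (\<lambda>x. x ^ (d - 1 + j) * G x)"
      "set_integrable lborel {0..} (\<lambda>x. s\<^sup>2 * (x ^ (d - 1 + i) * G x))"
      using ex unfolding Bmom_exists_def by auto
    fix x :: real assume "x \<in> {0..}"
    then have x: "x \<ge> 0" by simp
    have "(x\<^sup>2 - s\<^sup>2) * G x \<le> 0"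
    proof (cases "x \<le> s")
      case True
      then have "x\<^sup>2 \<le> s\<^sup>2" using x by (simp add: power_mono)
      then show ?thesis using nonneg[OF x True] by (simp add: mult_nonpos_nonneg)
    next
      case False
      then have "s\<^sup>2 \<le> x\<^sup>2" using s by (simp add: power_mono)
      then show ?thesis using nonpos[of x] False by (simp add: mult_nonneg_nonpos)
    qed
    then have "x ^ (d - 1 + i) * ((x\<^sup>2 - s\<^sup>2) * G x) \<le> 0"
      using x by (simp add: mult_nonneg_nonpos)
    then show "x ^ (d - 1 + j) * G x \<le> s\<^sup>2 * (x ^ (d - 1 + i) * G x)"
      by (simp add: j power_add algebra_simps power2_eq_square)
  qed
  then show ?thesis unfolding Bmom_def by simp
qed

lemma changes_sign_0D:
  assumes "changes_sign g 0"
  shows "(\<forall>x\<ge>0. g x \<ge> 0) \<or> (\<forall>x\<ge>0. g x \<le> 0)"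
  using assms unfolding changes_sign_def seg_def by auto

lemma changes_sign_1D:
  assumes "changes_sign g 1"
  obtains s where "s > 0" and "(\<forall>x. 0 \<le> x \<and> x \<le> s \<longrightarrow> g x \<ge> 0) \<and> (\<forall>x\<ge>s. g x \<le> 0) \<or>
    (\<forall>x. 0 \<le> x \<and> x \<le> s \<longrightarrow> g x \<le> 0) \<and> (\<forall>x\<ge>s. g x \<ge> 0)"
proof -
  obtain xs where xs: "xs 0 = 0" "\<forall>j<1. xs j < xs (Suc j)"
    and sgn: "\<forall>j\<in>{1..1+1}. ((\<forall>x\<in>seg xs 1 j. g x \<le> 0) \<and> (\<exists>x\<in>seg xs 1 j. g x < 0)) \<or>
           ((\<forall>x\<in>seg xs 1 j. g x \<ge> 0) \<and> (\<exists>x\<in>seg xs 1 j. g x > 0))"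
    and alt: "\<forall>j\<in>{1..1}. \<forall>x\<in>seg xs 1 j. \<forall>y\<in>seg xs 1 (j + 1). g x * g y \<le> 0"
    using assms unfolding changes_sign_def by auto
  define s where "s = xs 1"
  have s: "s > 0" using xs by (simp add: s_def)
  have seg: "seg xs 1 1 = {0..s}" "seg xs 1 2 = {s..}"
    using xs by (simp_all add: seg_def s_def)
  have alt': "g x * g y \<le> 0" if "x \<in> {0..s}" "y \<in> {s..}" for x y
    using alt seg that by (auto simp: numeral_2_eq_2)
  have "((\<forall>x\<in>{0..s}. g x \<le> 0) \<and> (\<exists>x\<in>{0..s}. g x < 0)) \<or>
        ((\<forall>x\<in>{0..s}. g x \<ge> 0) \<and> (\<exists>x\<in>{0..s}. g x > 0))"
    using sgn[rule_format, of 1] unfolding seg by simp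
  then show thesis
  proof (elim disjE conjE bexE)
    fix x assume x: "\<forall>x\<in>{0..s}. g x \<le> 0" "x \<in> {0..s}" "g x < 0"
    \<comment> \<open>A strict sign at a single point of the first segment, put into the alternation
      inequality, fixes the sign on the whole second segment.\<close>
    then have "\<forall>y\<ge>s. g y \<ge> 0" using alt'[OF x(2)] by (force simp: mult_le_0_iff)
    then show thesis using x by (intro that[OF s]) auto
  next
    fix x assume x: "\<forall>x\<in>{0..s}. g x \<ge> 0" "x \<in> {0..s}" "g x > 0"
    then have "\<forall>y\<ge>s. g y \<le> 0" using alt'[OF x(2)] by (force simp: mult_le_0_iff)
    then show thesis using x by (intro that[OF s]) auto
  qed
qed

section \<open>Jacobi polynomials and the kernel\<close>

text \<open>The description operator is resolved because polynomials agreeing on the infinite set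
  (-1,1) coincide.\<close>

lemma jacobiP_eqI:
  fixes p :: "real poly"
  assumes "\<And>y. -1 < y \<Longrightarrow> y < 1 \<Longrightarrow> jacobi_rodrigues n a b y = poly p y"
  shows "jacobiP n a b x = poly p x"
proof -
  have "(THE p. \<forall>y\<in>{-1<..<1}. poly p y = jacobi_rodrigues n a b y) = p"
  proof (rule the_equality)
    show "\<forall>y\<in>{-1<..<1}. poly p y = jacobi_rodrigues n a b y"
      using assms by auto
    fix r assume r: "\<forall>y\<in>{-1<..<1}. poly r y = jacobi_rodrigues n a b y"
    have "{-1<..<1} \<subseteq> {y. poly (r - p) y = 0}"
      using r assms by auto
    moreover have "infinite {-1<..<1::real}" by (simp add: infinite_Ioo)
    ultimately have "infinite {y. poly (r - p) y = 0}"
      using finite_subset by blast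
    then have "r - p = 0" using poly_roots_finite by blast
    then show "r = p" by simp
  qed
  then show ?thesis by (simp add: jacobiP_def)
qed

text \<open>Replaces iterated \<open>deriv\<close> by an explicit table of derivatives. The equality
  is carried on a whole open set, since each further derivative depends on neighbouring
  values.\<close>

lemma funpow_deriv_eq_on_open:
  fixes f :: "nat \<Rightarrow> real \<Rightarrow> real"
  assumes S: "open S" and F: "\<And>x. x \<in> S \<Longrightarrow> F x = f 0 x"
    and f: "\<And>i x. i < n \<Longrightarrow> x \<in> S \<Longrightarrow> (f i has_real_derivative f (Suc i) x) (at x)"
    and x: "x \<in> S"
  shows "(deriv ^^ n) F x = f n x"
  using f x
proof (induction n arbitrary: x)
  case 0
  then show ?case using F by simp
next
  case (Suc n)
  have "((deriv ^^ n) F has_real_derivative f (Suc n) x) (at x)"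
    by (rule has_field_derivative_transform_within_open[of "f n" _ _ S])
       (use Suc S in auto)
  then show ?case by (simp add: DERIV_imp_deriv)
qed

text \<open>Shape of the Rodrigues formula after the powers are pulled out of the derivative:
  \<open>u\<close> and \<open>w\<close> are the outer weights, \<open>v\<close> and \<open>z\<close>
  the powers cancelling them, \<open>r\<close> the remaining polynomial.\<close>

lemma weights_cancel:
  fixes u v w z :: real
  assumes "u * v = 1" and "w * z = 1"
  shows "c * u * w * (v * z * r) = c * r"
proof -
  have "c * u * w * (v * z * r) = (u * v) * (w * z) * (c * r)" by simp
  then show ?thesis using assms by simp
qed

lemma jacobiP_0: "jacobiP 0 a b x = 1"
proof -
  have "jacobiP 0 a b x = poly 1 x"
    by (rule jacobiP_eqI) (simp add: jacobi_rodrigues_def powr_minus field_simps)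
  then show ?thesis by simp
qed

lemma jacobiP_1_left_2: "jacobiP 1 2 b x = (3 * (1 + x) - (1 + b) * (1 - x)) / 2"
proof -
  have "jacobiP 1 2 b x = poly (smult (1/2) (smult 3 [:1, 1:] - smult (1 + b) [:1, -1:])) x"
  proof (rule jacobiP_eqI)
    fix y :: real assume y: "-1 < y" "y < 1"
    define f :: "nat \<Rightarrow> real \<Rightarrow> real" where "f = (\<lambda>i y. if i = 0 then (1 - y) ^ 3 * (1 + y) powr (1 + b)
      else - 3 * (1 - y)\<^sup>2 * (1 + y) powr (1 + b) + (1 + b) * (1 - y) ^ 3 * (1 + y) powr b)"
    have D: "(deriv ^^ 1) (\<lambda>y. (1 - y) powr (real 1 + 2) * (1 + y) powr (real 1 + b)) y = f 1 y"
    proof (rule funpow_deriv_eq_on_open[where S="{-1<..<1}"])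
      show "(1 - x) powr (real 1 + 2) * (1 + x) powr (real 1 + b) = f 0 x" if "x \<in> {-1<..<1}" for x
        using that powr_realpow[of "1 - x" 3] by (simp add: f_def)
      show "(f i has_real_derivative f (Suc i) x) (at x)" if "i < 1" "x \<in> {-1<..<1}" for i x
        using that by (auto simp: f_def intro!: derivative_eq_intros)
    qed (use y in auto)
    have "(1 + y) powr (1 + b) = (1 + y) * (1 + y) powr b"
      using y by (simp add: powr_add)
    then have f1: "f 1 y = (1 - y)\<^sup>2 * (1 + y) powr b * ((1 + b) * (1 - y) - 3 * (1 + y))"
      by (simp add: f_def power3_eq_cube power2_eq_square algebra_simps)
    have "(1 - y) powr (-2) * (1 - y)\<^sup>2 = 1" "(1 + y) powr (- b) * (1 + y) powr b = 1"
      using y powr_realpow[of "1 - y" 2] by (simp_all add: powr_minus)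
    then have "jacobi_rodrigues 1 2 b y = (-1) ^ 1 / (2 ^ 1 * fact 1) * ((1 + b) * (1 - y) - 3 * (1 + y))"
      unfolding jacobi_rodrigues_def D f1 by (rule weights_cancel)
    then show "jacobi_rodrigues 1 2 b y =
        poly (smult (1/2) (smult 3 [:1, 1:] - smult (1 + b) [:1, -1:])) y"
      by (simp add: field_simps)
  qed
  then show ?thesis by (simp add: field_simps)
qed

text \<open>The exponent of 1 + y under the derivative is 2 - 2 = 0, so only a power of 1 - y is
  differentiated.\<close>

lemma jacobiP_2_right_minus_2: "jacobiP 2 a (-2) x = (a + 1) * (a + 2) / 8 * (1 + x)\<^sup>2"
proof -
  have "jacobiP 2 a (-2) x = poly (smult ((a + 1) * (a + 2) / 8) ([:1, 1:] ^ 2)) x"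
  proof (rule jacobiP_eqI)
    fix y :: real assume y: "-1 < y" "y < 1"
    define f :: "nat \<Rightarrow> real \<Rightarrow> real" where "f = (\<lambda>i y. if i = 0 then (1 - y) powr (2 + a)
      else if i = 1 then - (2 + a) * (1 - y) powr (1 + a)
      else (2 + a) * (1 + a) * (1 - y) powr a)"
    have D: "(deriv ^^ 2) (\<lambda>y. (1 - y) powr (real 2 + a) * (1 + y) powr (real 2 + -2)) y = f 2 y"
    proof (rule funpow_deriv_eq_on_open[where S="{-1<..<1}"])
      show "(1 - x) powr (real 2 + a) * (1 + x) powr (real 2 + -2) = f 0 x" if "x \<in> {-1<..<1}" for x
        using that by (simp add: f_def)
      show "(f i has_real_derivative f (Suc i) x) (at x)" if "i < 2" "x \<in> {-1<..<1}" for i x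
      proof -
        have "i = 0 \<or> i = 1" using that by auto
        then show ?thesis
          using that by (auto simp: f_def algebra_simps intro!: derivative_eq_intros)
      qed
    qed (use y in auto)
    have "(1 + y) powr 2 = (1 + y)\<^sup>2" using y by simp
    then show "jacobi_rodrigues 2 a (-2) y =
        poly (smult ((a + 1) * (a + 2) / 8) ([:1, 1:] ^ 2)) y"
      using y unfolding jacobi_rodrigues_def D
      by (simp add: f_def powr_minus field_simps power2_eq_square)
  qed
  then show ?thesis by simp
qed

text \<open>Here the exponent of 1 + y is 3 - 2 = 1, so a linear factor enters the table of
  derivatives.\<close>

lemma jacobiP_3_right_minus_2:
  "jacobiP 3 a (-2) x = (a + 2) * (a + 3) / 48 * (1 + x)\<^sup>2 * ((a + 1) * (1 + x) - 3 * (1 - x))"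
proof -
  let ?p = "smult ((a + 2) * (a + 3) / 48) ([:1, 1:] ^ 2 * (smult (a + 1) [:1, 1:] - smult 3 [:1, -1:]))"
  have "jacobiP 3 a (-2) x = poly ?p x"
  proof (rule jacobiP_eqI)
    fix y :: real assume y: "-1 < y" "y < 1"
    define f :: "nat \<Rightarrow> real \<Rightarrow> real" where "f = (\<lambda>i y. if i = 0 then (1 - y) powr (3 + a) * (1 + y)
      else if i = 1 then - (3 + a) * (1 - y) powr (2 + a) * (1 + y) + (1 - y) powr (3 + a)
      else if i = 2 then (3 + a) * (2 + a) * (1 - y) powr (1 + a) * (1 + y)
        - 2 * (3 + a) * (1 - y) powr (2 + a)
      else 3 * (3 + a) * (2 + a) * (1 - y) powr (1 + a)
        - (3 + a) * (2 + a) * (1 + a) * (1 - y) powr a * (1 + y))"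
    have D: "(deriv ^^ 3) (\<lambda>y. (1 - y) powr (real 3 + a) * (1 + y) powr (real 3 + -2)) y = f 3 y"
    proof (rule funpow_deriv_eq_on_open[where S="{-1<..<1}"])
      show "(1 - x) powr (real 3 + a) * (1 + x) powr (real 3 + -2) = f 0 x" if "x \<in> {-1<..<1}" for x
        using that by (simp add: f_def)
      show "(f i has_real_derivative f (Suc i) x) (at x)" if "i < 3" "x \<in> {-1<..<1}" for i x
      proof -
        have "i = 0 \<or> i = 1 \<or> i = 2" using that by auto
        then show ?thesis
          using that by (auto simp: f_def algebra_simps intro!: derivative_eq_intros)
      qed
    qed (use y in auto)
    have powr_Suc: "(1 - y) powr (1 + a) = (1 - y) * (1 - y) powr a"
      using y by (simp add: powr_add)
    have f3: "f 3 y = (1 - y) powr a * ((3 + a) * (2 + a) * (3 * (1 - y) - (1 + a) * (1 + y)))"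
      by (simp add: f_def powr_Suc algebra_simps)
    show "jacobi_rodrigues 3 a (-2) y = poly ?p y"
      using y unfolding jacobi_rodrigues_def D f3
      by (simp add: powr_minus field_simps fact_numeral)
  qed
  then show ?thesis by (simp add: field_simps)
qed

text \<open>For q = 2 the Gamma factors in (d + 2 + i)/2 cancel, leaving the binomial coefficients
  of (1 - x^2)^2.\<close>

lemma GB_2_eq_bump:
  "GB d 2 = bump (Gamma (real d / 2 + 3) / (2 * pi powr (real d / 2))) 1 0"
proof
  fix x
  have I: "{i\<in>{0..2+2}. even i} = {0, 2, 4::nat}"
    by (rule set_eqI, simp, presburger)
  have cB: "cB d 2 (2 * k) = (-1) ^ k * Gamma (real d / 2 + 3) /
      (pi powr (real d / 2) * fact k * fact (2 - k))" if "k \<le> 2" for k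
  proof -
    let ?z = "real d / 2 + 1 + real k"
    have pos: "Gamma ?z \<noteq> 0"
      by (intro less_imp_neq[symmetric] Gamma_real_pos) (simp add: add_nonneg_pos)
    have args: "(real d + real 2 + real (2 * k)) / 2 = ?z" "(real d + 2 + real (2 * k)) / 2 = ?z"
      "(real d + real 2 + 4) / 2 = real d / 2 + 3" "(2 + real (2 * k)) / 2 = 1 + real k"
      "(real 2 + 4 - real (2 * k)) / 2 = 1 + real (2 - k)" "real 2 / 2 = 1 + real 0" "2 * k div 2 = k"
      using that by (simp_all add: field_simps of_nat_diff)
    show ?thesis
      using pos unfolding cB_def args Gamma_fact by simp
  qed
  have "cB d 2 0 = Gamma (real d / 2 + 3) / (2 * pi powr (real d / 2))"
    "cB d 2 2 = - (Gamma (real d / 2 + 3) / pi powr (real d / 2))"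
    "cB d 2 4 = Gamma (real d / 2 + 3) / (2 * pi powr (real d / 2))"
    using cB[of 0] cB[of 1] cB[of 2] by simp_all
  then show "GB d 2 x = bump (Gamma (real d / 2 + 3) / (2 * pi powr (real d / 2))) 1 0 x"
    unfolding GB_def I bump_def by (simp add: field_simps power2_eq_square eval_nat_numeral)
qed

text \<open>For q = 4 the corresponding Gamma quotient is the linear factor d/2 + 1 + k, with i =
  2k. The resulting cubic in x^2 has a double root at 1.\<close>

lemma GB_4_eq_bump:
  "GB d 4 = bump (Gamma (real d / 2 + 4) / (12 * pi powr (real d / 2))) (real d + 2) (real d + 8)"
proof
  fix x
  have I: "{i\<in>{0..4+2}. even i} = {0, 2, 4, 6::nat}"
    by (rule set_eqI, simp, presburger)
  have cB: "cB d 4 (2 * k) = (-1) ^ k * Gamma (real d / 2 + 4) * (real d / 2 + 1 + real k) /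
      (pi powr (real d / 2) * fact k * fact (3 - k))" if "k \<le> 3" for k
  proof -
    let ?z = "real d / 2 + 1 + real k"
    have pos: "Gamma ?z \<noteq> 0"
      by (intro less_imp_neq[symmetric] Gamma_real_pos) (simp add: add_nonneg_pos)
    have rec: "Gamma (?z + 1) = ?z * Gamma ?z"
      by (intro Gamma_plus1) (auto dest!: nonpos_Ints_nonpos)
    have args: "(real d + real 4 + real (2 * k)) / 2 = ?z + 1" "(real d + 2 + real (2 * k)) / 2 = ?z"
      "(real d + real 4 + 4) / 2 = real d / 2 + 4" "(2 + real (2 * k)) / 2 = 1 + real k"
      "(real 4 + 4 - real (2 * k)) / 2 = 1 + real (3 - k)" "real 4 / 2 = 1 + real 1" "2 * k div 2 = k"
      using that by (simp_all add: field_simps of_nat_diff)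
    show ?thesis
      using pos unfolding cB_def args rec Gamma_fact by simp
  qed
  define K where "K = Gamma (real d / 2 + 4) / (12 * pi powr (real d / 2))"
  have c: "cB d 4 0 = K * (real d + 2)" "cB d 4 2 = - (K * (3 * (real d + 4)))"
    "cB d 4 4 = K * (3 * (real d + 6))" "cB d 4 6 = - (K * (real d + 8))"
    using cB[of 0] cB[of 1] cB[of 2] cB[of 3]
    by (simp_all add: K_def fact_numeral field_simps flip: numeral_2_eq_2)
  have "K * (real d + 2) - K * (3 * (real d + 4)) * x\<^sup>2 + K * (3 * (real d + 6)) * x ^ 4
      - K * (real d + 8) * x ^ 6 = K * (1 - x\<^sup>2)\<^sup>2 * (real d + 2 - (real d + 8) * x\<^sup>2)"
    by (simp add: algebra_simps eval_nat_numeral)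
  then show "GB d 4 x =
      bump (Gamma (real d / 2 + 4) / (12 * pi powr (real d / 2))) (real d + 2) (real d + 8) x"
    unfolding GB_def I bump_def K_def[symmetric] by (simp add: c)
qed

section \<open>Optimality\<close>

lemma objective_le_of_scaled_Vfun_le:
  assumes d: "d \<ge> 1" and q: "q > 0" and H: "set_integrable lborel {0..} H"
    and ratio: "Bmom d q G / Bmom d q g > 0"
    and V: "\<And>L. L > 0 \<Longrightarrow> Bmom d q (\<lambda>x. L ^ d * G (L * x)) = Bmom d q g \<Longrightarrow>
      Vfun d g' \<le> Vfun d (\<lambda>x. L ^ (d + 1) * H (L * x))"
  shows "objective d q g g' \<le> objective d q G H"
proof -
  \<comment> \<open>Rescaling divides the moment of order \<open>q\<close> by \<open>L ^ q\<close>,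
    so this root matches it to that of \<open>g\<close>; the positive ratio makes \<open>L\<close>
    positive.\<close>
  define L where "L = root q (Bmom d q G / Bmom d q g)"
  have L: "L > 0" "L ^ q = Bmom d q G / Bmom d q g"
    using q ratio by (simp_all add: L_def)
  have ne: "Bmom d q g \<noteq> 0" using ratio by auto
  then have LB: "L ^ q * Bmom d q g = Bmom d q G"
    using L(2) by simp
  have "Bmom d q (\<lambda>x. L ^ d * G (L * x)) = Bmom d q g"
    unfolding scaled_profile(2)[OF L(1) d] using LB L(1) by (simp add: field_simps)
  then have le: "Vfun d g' \<le> L ^ (d + 2) * Vfun d H"
    using V[OF L(1)] scaled_profile(6)[OF L(1) d H] by simp
  have nonneg: "Vfun d g' \<ge> 0" by (simp add: Vfun_def)
  \<comment> \<open>The even exponent keeps the moment factor nonnegative even for q = 4, where the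
    moment of the kernel is negative.\<close>
  have "Bmom d q g ^ (2 * (d + 2)) * Vfun d g' ^ (2 * q)
      \<le> Bmom d q g ^ (2 * (d + 2)) * (L ^ (d + 2) * Vfun d H) ^ (2 * q)"
    by (intro mult_left_mono power_mono le nonneg zero_le_even_power) simp
  also have "(L ^ (d + 2) * Vfun d H) ^ (2 * q) = (L ^ q) ^ (2 * (d + 2)) * Vfun d H ^ (2 * q)"
    by (simp only: power_mult_distrib power_mult[symmetric] mult_ac)
  also have "Bmom d q g ^ (2 * (d + 2)) * \<dots> = (L ^ q * Bmom d q g) ^ (2 * (d + 2)) * Vfun d H ^ (2 * q)"
    by (simp only: power_mult_distrib mult_ac)
  finally show ?thesis
    unfolding objective_def LB .
qed

section \<open>Admissibility of the truncated kernels\<close>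

lemma bump_sign:
  assumes "C \<ge> 0" and "x \<le> 1"
  shows "A \<ge> B * x\<^sup>2 \<Longrightarrow> bump C A B x \<ge> 0" and "A \<le> B * x\<^sup>2 \<Longrightarrow> bump C A B x \<le> 0"
  using assms by (simp_all add: bump_def mult_nonneg_nonpos)

lemma bump_weighted_tendsto_0: "((\<lambda>x. x ^ n * bump C A B x) \<longlongrightarrow> 0) at_top"
  by (rule tendsto_eventually)
     (auto simp: bump_def eventually_at_top_linorder intro!: exI[of _ "2::real"])

lemma changes_sign_bump_0:
  assumes "C > 0"
  shows "changes_sign (bump C 1 0) 0"
proof -
  have "bump C 1 0 x \<ge> 0" for x using assms by (simp add: bump_def)
  moreover have "bump C 1 0 0 > 0" using assms by (simp add: bump_def)
  ultimately show ?thesis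
    unfolding changes_sign_def seg_def by (intro exI[of _ "\<lambda>_. 0"]) auto
qed

lemma changes_sign_bump_1:
  assumes C: "C > 0" and A: "0 < A" and AB: "A < B"
  shows "changes_sign (bump C A B) 1"
proof -
  \<comment> \<open>The positive root of A - B x^2; it lies inside the support because A <
    B.\<close>
  define s where "s = sqrt (A / B)"
  have s: "0 < s" "s < 1" "B * s\<^sup>2 = A"
    using A AB by (simp_all add: s_def)
  define xs where "xs = (\<lambda>j::nat. real j * s)"
  have seg: "seg xs 1 1 = {0..s}" "seg xs 1 2 = {s..}"
    by (simp_all add: seg_def xs_def)
  have nonneg: "bump C A B x \<ge> 0" if "x \<in> {0..s}" for x
  proof -
    have "B * x\<^sup>2 \<le> B * s\<^sup>2" using that A AB by (intro mult_left_mono power_mono) auto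
    then show ?thesis using that s C by (intro bump_sign) auto
  qed
  have nonpos: "bump C A B x \<le> 0" if "x \<in> {s..}" for x
  proof (cases "x \<le> 1")
    case True
    have "B * s\<^sup>2 \<le> B * x\<^sup>2" using that s A AB by (intro mult_left_mono power_mono) auto
    then show ?thesis using True s C by (intro bump_sign) auto
  qed (simp add: bump_def)
  have pos: "bump C A B 0 > 0" using C A by (simp add: bump_def)
  have neg: "\<exists>x\<in>{s..}. bump C A B x < 0"
  proof
    define x where "x = (s + 1) / 2"
    have x: "s < x" "0 < x" "x < 1" using s by (simp_all add: x_def)
    have "B * s\<^sup>2 < B * x\<^sup>2" using x s A AB by (intro mult_strict_left_mono power_strict_mono) auto
    moreover have "x\<^sup>2 < 1" using x by (simp add: power_less_one_iff)
    ultimately show "bump C A B x < 0"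
      using C s x by (simp add: bump_def mult_pos_neg)
    show "x \<in> {s..}" using x by simp
  qed
  have J: "{1..1+1} = {1, 2::nat}" by auto
  show ?thesis
    unfolding changes_sign_def
  proof (intro exI[of _ xs] conjI impI)
    show "xs 0 = 0" "\<forall>j<1. xs j < xs (Suc j)" using s by (simp_all add: xs_def)
    have "0 \<in> {0..s}" using s by simp
    then show "\<forall>j\<in>{1..1+1}. ((\<forall>x\<in>seg xs 1 j. bump C A B x \<le> 0) \<and> (\<exists>x\<in>seg xs 1 j. bump C A B x < 0)) \<or>
           ((\<forall>x\<in>seg xs 1 j. bump C A B x \<ge> 0) \<and> (\<exists>x\<in>seg xs 1 j. bump C A B x > 0))"
      unfolding J using nonneg nonpos pos neg seg by blast
    show "\<forall>j\<in>{1..1}. \<forall>x\<in>seg xs 1 j. \<forall>y\<in>seg xs 1 (j + 1). bump C A B x * bump C A B y \<le> 0"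
      using nonneg nonpos seg by (auto simp: numeral_2_eq_2 intro!: mult_nonneg_nonpos)
  qed
qed

lemma feasible_bump:
  assumes d: "d \<ge> 1" and "Bmom d 0 (bump C A B) = 1 / b_const d"
    and "\<And>i. i \<in> {2..q-2} \<Longrightarrow> even i \<Longrightarrow> Bmom d i (bump C A B) = 0"
    and "Bmom d q (bump C A B) \<noteq> 0" and "changes_sign (bump C A B) (q div 2 - 1)"
  shows "feasible d q (bump C A B) (bump' C A B)"
  unfolding feasible_def
  by (intro conjI ballI allI impI Bmom_bump(1)[OF d] set_integrable_bump' Vfun_bump'_finite
      bump_weighted_tendsto_0 has_field_derivative_at_within[OF bump_has_real_derivative])
     (use assms in auto)

lemma Gamma_plus1_pos: "x > 0 \<Longrightarrow> Gamma (x + 1) = x * Gamma (x::real)"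
  by (intro Gamma_plus1) (auto dest!: nonpos_Ints_nonpos)

lemma inverse_b_const:
  assumes "d \<ge> 1"
  shows "1 / b_const d = Gamma (real d / 2) / (2 * pi powr (real d / 2))" and "1 / b_const d > 0"
proof -
  have "Gamma (real d / 2) > 0" using assms by (intro Gamma_real_pos) auto
  then show "1 / b_const d = Gamma (real d / 2) / (2 * pi powr (real d / 2))" "1 / b_const d > 0"
    by (simp_all add: b_const_def)
qed

text \<open>\<open>C\<close> normalises the zeroth moment. For a competitor the positive zeroth
  moment selects G \<ge> 0, so its second moment is positive like that of the kernel, as the
  rescaling requires.\<close>

lemma bump_optimal_2:
  fixes d :: nat
  defines "C \<equiv> Gamma (real d / 2 + 3) / (2 * pi powr (real d / 2))"
  assumes d: "d \<ge> 1"
  shows "feasible d 2 (bump C 1 0) (bump' C 1 0)"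
    and "feasible d 2 G H \<Longrightarrow> objective d 2 (bump C 1 0) (bump' C 1 0) \<le> objective d 2 G H"
proof -
  have C: "C > 0"
    unfolding C_def by (intro divide_pos_pos Gamma_real_pos) auto
  define e where "e = real d / 2"
  have e: "e > 0" "real d = 2 * e" using d by (simp_all add: e_def)
  have "Gamma (e + 3) = (e + 2) * (e + 1) * e * Gamma e"
    using Gamma_plus1_pos[of e] Gamma_plus1_pos[of "e + 1"] Gamma_plus1_pos[of "e + 2"] e
    by (simp add: add.assoc)
  then have CG: "C = (e + 2) * (e + 1) * e * Gamma e / (2 * pi powr e)"
    unfolding C_def e_def[symmetric] by simp
  have B0: "Bmom d 0 (bump C 1 0) = 1 / b_const d"
    unfolding Bmom_bump(2)[OF d] inverse_b_const(1)[OF d] e_def[symmetric] CG e(2) using e(1)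
    by (simp add: divide_simps) (simp add: algebra_simps)
  have "Bmom d 2 (bump C 1 0) = C * (8 / ((real d + 2) * (real d + 4) * (real d + 6)))"
    unfolding Bmom_bump(2)[OF d] by (simp add: divide_simps) (simp add: algebra_simps)
  then have B2: "Bmom d 2 (bump C 1 0) > 0"
    using C by simp
  show "feasible d 2 (bump C 1 0) (bump' C 1 0)"
    using B0 B2 changes_sign_bump_0[OF C] by (intro feasible_bump d) auto
  assume "feasible d 2 G H"
  then have f: "Bmom_exists d 0 G" "Bmom d 0 G = 1 / b_const d" "Bmom_exists d 2 G" "Bmom d 2 G \<noteq> 0"
    "\<And>x. x \<ge> 0 \<Longrightarrow> (G has_real_derivative H x) (at x within {0..})"
    "set_integrable lborel {0..} H" "changes_sign G 0" "Vfun_ennreal d H < \<infinity>"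
    unfolding feasible_def by auto
  have "\<not> (\<forall>x\<ge>0. G x \<le> 0)"
    using Bmom_nonneg[of "\<lambda>x. - G x" d 0] inverse_b_const(2)[OF d] f(2) by (auto simp: Bmom_uminus)
  then have nonneg: "G x \<ge> 0" if "x \<ge> 0" for x
    using changes_sign_0D[OF f(7)] that by blast
  have "Bmom d 2 G > 0"
    using Bmom_nonneg[of G d 2] nonneg f(4) by simp
  then have ratio: "Bmom d 2 G / Bmom d 2 (bump C 1 0) > 0"
    using B2 by simp
  show "objective d 2 (bump C 1 0) (bump' C 1 0) \<le> objective d 2 G H"
  proof (rule objective_le_of_scaled_Vfun_le[OF d _ f(6) ratio])
    fix L :: real assume L: "L > 0" "Bmom d 2 (\<lambda>x. L ^ d * G (L * x)) = Bmom d 2 (bump C 1 0)"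
    show "Vfun d (bump' C 1 0) \<le> Vfun d (\<lambda>x. L ^ (d + 1) * H (L * x))"
    proof (rule Vfun_bump'_le_nonneg[OF d, where G="\<lambda>x. L ^ d * G (L * x)"])
      show "Bmom d 0 (\<lambda>x. L ^ d * G (L * x)) = Bmom d 0 (bump C 1 0)"
        using f(2) B0 by (simp add: scaled_profile(2)[OF L(1) d])
      show "L ^ d * G (L * x) \<ge> 0" if "x \<ge> 0" for x
        using L nonneg that by simp
    qed (use C L(2) scaled_profile(1,3-5)[OF L(1) d] f in auto)
  qed simp
qed

text \<open>The second moment of \<open>bump C A B\<close> is proportional to A/(d + 2) - B/(d + 8),
  which dictates \<open>A\<close> and \<open>B\<close> up to scale; \<open>C\<close> then normalises
  the zeroth moment.\<close>

lemma bump_optimal_4: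
  fixes d :: nat
  defines "C \<equiv> Gamma (real d / 2 + 4) / (12 * pi powr (real d / 2))"
    and "A \<equiv> real d + 2" and "B \<equiv> real d + 8"
  assumes d: "d \<ge> 1"
  shows "feasible d 4 (bump C A B) (bump' C A B)"
    and "feasible d 4 G H \<Longrightarrow> objective d 4 (bump C A B) (bump' C A B) \<le> objective d 4 G H"
proof -
  have C: "C > 0"
    unfolding C_def by (intro divide_pos_pos Gamma_real_pos) auto
  define e where "e = real d / 2"
  have e: "e > 0" "real d = 2 * e" using d by (simp_all add: e_def)
  have "Gamma (e + 4) = (e + 3) * (e + 2) * (e + 1) * e * Gamma e"
    using Gamma_plus1_pos[of e] Gamma_plus1_pos[of "e + 1"] Gamma_plus1_pos[of "e + 2"] Gamma_plus1_pos[of "e + 3"] e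
    by (simp add: add.assoc)
  then have CG: "C = (e + 3) * (e + 2) * (e + 1) * e * Gamma e / (12 * pi powr e)"
    unfolding C_def e_def[symmetric] by simp
  have B0: "Bmom d 0 (bump C A B) = 1 / b_const d"
    unfolding Bmom_bump(2)[OF d] inverse_b_const(1)[OF d] e_def[symmetric] CG A_def B_def e(2) using e(1)
    by (simp add: divide_simps) (simp add: algebra_simps)
  have B2: "Bmom d 2 (bump C A B) = 0"
    unfolding Bmom_bump(2)[OF d] A_def B_def by (simp add: divide_simps) (simp add: algebra_simps)
  have "Bmom d 4 (bump C A B) = - (C * (96 / ((real d + 4) * (real d + 6) * (real d + 8) * (real d + 10))))"
    unfolding Bmom_bump(2)[OF d] A_def B_def by (simp add: divide_simps) (simp add: algebra_simps)
  then have B4: "Bmom d 4 (bump C A B) < 0"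
    using C by (simp add: mult_pos_pos)
  show "feasible d 4 (bump C A B) (bump' C A B)"
  proof (rule feasible_bump[OF d B0])
    show "Bmom d i (bump C A B) = 0" if "i \<in> {2..4-2}" "even i" for i
      using that B2 by simp
    have "changes_sign (bump C A B) 1"
      by (rule changes_sign_bump_1[OF C]) (simp_all add: A_def B_def add_nonneg_pos)
    then show "changes_sign (bump C A B) (4 div 2 - 1)" by simp
  qed (use B4 in simp)
  assume "feasible d 4 G H"
  then have f: "Bmom_exists d 0 G" "Bmom d 0 G = 1 / b_const d" "Bmom_exists d 2 G" "Bmom d 2 G = 0"
    "Bmom_exists d 4 G" "Bmom d 4 G \<noteq> 0"
    "\<And>x. x \<ge> 0 \<Longrightarrow> (G has_real_derivative H x) (at x within {0..})"
    "set_integrable lborel {0..} H" "changes_sign G 1" "Vfun_ennreal d H < \<infinity>"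
    unfolding feasible_def by auto
  obtain s where s: "s > 0" and sgn: "(\<forall>x. 0 \<le> x \<and> x \<le> s \<longrightarrow> G x \<ge> 0) \<and> (\<forall>x\<ge>s. G x \<le> 0) \<or>
    (\<forall>x. 0 \<le> x \<and> x \<le> s \<longrightarrow> G x \<le> 0) \<and> (\<forall>x\<ge>s. G x \<ge> 0)"
    using changes_sign_1D[OF f(9)] by blast
  \<comment> \<open>If \<open>G\<close> started nonpositive, comparing moments 0 and 2 of
    \<open>-G\<close> would give 0 \<le> -s^2 / b_d, which is absurd.\<close>
  have "\<not> ((\<forall>x. 0 \<le> x \<and> x \<le> s \<longrightarrow> G x \<le> 0) \<and> (\<forall>x\<ge>s. G x \<ge> 0))"
  proof
    assume neg: "(\<forall>x. 0 \<le> x \<and> x \<le> s \<longrightarrow> G x \<le> 0) \<and> (\<forall>x\<ge>s. G x \<ge> 0)"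
    have "Bmom_exists d i (\<lambda>x. - G x)" if "Bmom_exists d i G" for i
      using that unfolding Bmom_exists_def set_integrable_def by simp
    then have "Bmom d 2 (\<lambda>x. - G x) \<le> s\<^sup>2 * Bmom d 0 (\<lambda>x. - G x)"
      using f neg s by (intro Bmom_sign_change_le) auto
    then have "s\<^sup>2 * (1 / b_const d) \<le> 0"
      using f(2,4) by (simp add: Bmom_uminus)
    moreover have "s\<^sup>2 * (1 / b_const d) > 0"
      using s inverse_b_const(2)[OF d] by (intro mult_pos_pos) auto
    ultimately show False by simp
  qed
  then have nonneg: "\<And>x. 0 \<le> x \<Longrightarrow> x \<le> s \<Longrightarrow> G x \<ge> 0" and nonpos: "\<And>x. x \<ge> s \<Longrightarrow> G x \<le> 0"
    using sgn by blast+
  \<comment> \<open>The second moment is zero, so the fourth is nonpositive, and the constraint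
    excludes 0; the kernel has the same sign.\<close>
  have "Bmom d 4 G \<le> s\<^sup>2 * Bmom d 2 G"
    using f nonneg nonpos s by (intro Bmom_sign_change_le) auto
  then have "Bmom d 4 G < 0"
    using f(4,6) by simp
  then have ratio: "Bmom d 4 G / Bmom d 4 (bump C A B) > 0"
    using B4 by (simp add: divide_neg_neg)
  show "objective d 4 (bump C A B) (bump' C A B) \<le> objective d 4 G H"
  proof (rule objective_le_of_scaled_Vfun_le[OF d _ f(8) ratio])
    fix L :: real assume L: "L > 0" "Bmom d 4 (\<lambda>x. L ^ d * G (L * x)) = Bmom d 4 (bump C A B)"
    show "Vfun d (bump' C A B) \<le> Vfun d (\<lambda>x. L ^ (d + 1) * H (L * x))"
      unfolding A_def B_def
    proof (rule Vfun_bump'_le_one_sign_change[OF d, where G="\<lambda>x. L ^ d * G (L * x)" and s="s / L"],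
        unfold A_def[symmetric] B_def[symmetric])
      show "Bmom d 0 (\<lambda>x. L ^ d * G (L * x)) = Bmom d 0 (bump C A B)"
        using f(2) B0 by (simp add: scaled_profile(2)[OF L(1) d])
      show "Bmom d 2 (\<lambda>x. L ^ d * G (L * x)) = 0"
        using f(4) by (simp add: scaled_profile(2)[OF L(1) d])
      show "L ^ d * G (L * x) \<ge> 0" if "0 \<le> x" "x \<le> s / L" for x
        using L nonneg[of "L * x"] that by (simp add: field_simps)
      show "L ^ d * G (L * x) \<le> 0" if "x \<ge> s / L" for x
        using L nonpos[of "L * x"] that by (simp add: field_simps mult_nonneg_nonpos)
    qed (use C s B2 L scaled_profile(1,3-5)[OF L(1) d] f in auto)
  qed simp
qed

theorem theorem2:
  fixes d q :: nat
  assumes "d \<ge> 1" and "q \<in> {2, 4}"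
  shows "(\<exists>G'. feasible d q (GB d q) G' \<and>
            (\<forall>G H. feasible d q G H \<longrightarrow> objective d q (GB d q) G' \<le> objective d q G H)) \<and>
         (\<forall>x\<ge>0. GB d q x =
            Gamma ((real d + real q) / 2) / (pi powr (real d / 2) * Gamma (real q / 2)) *
              jacobiP (q div 2 + 1) (real d / 2) (-2) (1 - 2 * x\<^sup>2) * (if x \<le> 1 then 1 else 0)) \<and>
         (\<forall>x\<ge>0. GB d q x =
            (-1) ^ (q div 2 + 1) * Gamma ((real d + real q) / 2 + 2) /
              (pi powr (real d / 2) * Gamma (real q / 2 + 2)) *
              (1 - x\<^sup>2)\<^sup>2 * jacobiP (q div 2 - 1) 2 (real d / 2) (2 * x\<^sup>2 - 1) * (if x \<le> 1 then 1 else 0))"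
proof (intro conjI allI impI)
  show "\<exists>G'. feasible d q (GB d q) G' \<and>
      (\<forall>G H. feasible d q G H \<longrightarrow> objective d q (GB d q) G' \<le> objective d q G H)"
    using assms bump_optimal_2[of d] bump_optimal_4[of d] by (auto simp: GB_2_eq_bump GB_4_eq_bump)
next
  fix x :: real
  define e where "e = real d / 2"
  have e: "e > 0" "real d = 2 * e" using assms by (simp_all add: e_def)
  have rec: "Gamma (e + r + 1) = (e + r) * Gamma (e + r)" if "r \<ge> 0" for r
    using that e by (intro Gamma_plus1_pos) simp
  have G: "Gamma (e + 3) = (e + 2) * (e + 1) * Gamma (e + 1)"
    "Gamma (e + 4) = (e + 3) * (e + 2) * Gamma (e + 2)"
    using rec[of 1] rec[of 2] rec[of 3] by (simp_all add: add.assoc)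
  have args: "(real d + real 2) / 2 = e + 1" "(real d + real 4) / 2 = e + 2"
    "e + 1 + 2 = e + 3" "e + 2 + 2 = e + 4"
    by (simp_all add: e_def field_simps)
  consider "q = 2" | "q = 4" using assms by auto
  note q = this
  show "GB d q x =
      Gamma ((real d + real q) / 2) / (pi powr (real d / 2) * Gamma (real q / 2)) *
        jacobiP (q div 2 + 1) (real d / 2) (-2) (1 - 2 * x\<^sup>2) * (if x \<le> 1 then 1 else 0)"
  proof (cases rule: q)
    case 1
    \<comment> \<open>At y = 1 - 2x^2 one has 1 + y = 2(1 - x^2) and 1 - y = 2x^2.\<close>
    have J: "jacobiP (2 div 2 + 1) e (-2) (1 - 2 * x\<^sup>2) = (e + 1) * (e + 2) / 2 * (1 - x\<^sup>2)\<^sup>2"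
    proof -
      have "2 div 2 + 1 = (2::nat)" by simp
      then show ?thesis
        by (simp only: jacobiP_2_right_minus_2) (simp add: power2_eq_square field_simps)
    qed
    show ?thesis
      unfolding 1 GB_2_eq_bump bump_def args G e_def[symmetric] J by (simp add: mult_ac)
  next
    case 2
    have J: "jacobiP (4 div 2 + 1) e (-2) (1 - 2 * x\<^sup>2) =
        (e + 2) * (e + 3) / 6 * (1 - x\<^sup>2)\<^sup>2 * (e + 1 - (e + 4) * x\<^sup>2)"
    proof -
      have "4 div 2 + 1 = (3::nat)" by simp
      then show ?thesis
        by (simp only: jacobiP_3_right_minus_2) (simp add: power2_eq_square field_simps)
    qed
    show ?thesis
      unfolding 2 GB_4_eq_bump bump_def args G e_def[symmetric] J unfolding e(2)
      by (simp add: Gamma_numeral divide_simps)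
  qed
  show "GB d q x = (-1) ^ (q div 2 + 1) * Gamma ((real d + real q) / 2 + 2) /
      (pi powr (real d / 2) * Gamma (real q / 2 + 2)) *
      (1 - x\<^sup>2)\<^sup>2 * jacobiP (q div 2 - 1) 2 (real d / 2) (2 * x\<^sup>2 - 1) * (if x \<le> 1 then 1 else 0)"
  proof (cases rule: q)
    case 1
    show ?thesis
      unfolding 1 GB_2_eq_bump bump_def args e_def[symmetric]
      by (simp add: jacobiP_0 Gamma_numeral)
  next
    case 2
    \<comment> \<open>The minus sign cancels the prefactor \<open>(-1) ^ (q div 2 + 1)\<close>,
      which is -1 for q = 4.\<close>
    have J: "jacobiP (4 div 2 - 1) 2 e (2 * x\<^sup>2 - 1) = - (e + 1 - (e + 4) * x\<^sup>2)"
      using jacobiP_1_left_2[of e "2 * x\<^sup>2 - 1"] by (simp add: algebra_simps)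
    show ?thesis
      unfolding 2 GB_4_eq_bump bump_def args e_def[symmetric] J unfolding e(2)
      by (simp add: Gamma_numeral fact_numeral divide_simps) (simp add: algebra_simps)
  qed
qed

end
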